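(* Let $K\in\mathcal D_1$ and let $L(\lambda)$ be the Lax matrix, regarded as a matrix of functions on $\mathbf R^{2n\times r}$ with coordinates $\phi_{j\sigma}$. Suppose $\theta_1$ and $\theta_2$ are constant $2n\times2n$ matrices such that $[\theta_j,L(\lambda)]=0$ ($j=1,2$), identically in $\lambda$ and on $\mathbf R^{2n\times r}$. Then $$\{\mathrm{tr}(\theta_1L(\lambda)^k),\mathrm{tr}(\theta_2L(\mu)^l)\}=0$$ holds for any positive integers $k$ and $l$ and any complex numbers $\lambda$ and $\mu$ (at which $L(\lambda)$ and $L(\mu)$ are defined).
   Context: Algebraic setting. $W$ is a $2n\times 2n$ invertible antisymmetric real matrix. $G=\{A\in GL(2n,\mathbf C): A^TWA=W\}$ and $\mathfrak g=\{X\in gl(2n,\mathbf C): X^T=-WXW^{-1}\}$ is its Lie algebra. $\mathrm{pr}:G\to G/\{\pm I\}$ is the projection. $G_0$ is a finite subgroup of $G$ such that every $A\in G_0$ satisfies $\bar AA=\pm I$ (bar = entrywise complex conjugation); then $\mathrm{pr}(G_0)$ is Abelian. $\Omega_1,\dots,\Omega_N\in G_0$ are such that $\mathrm{pr}(\Omega_1),\dots,\mathrm{pr}(\Omega_N)$ generate $\mathrm{pr}(G_0)$, and $m_a$ is the order of $\mathrm{pr}(\Omega_a)$, so $\Omega_a^{m_a}=\pm I$. $\Sigma_0=\{\alpha=(\alpha_1,\dots,\alpha_N)\in\mathbf Z^N: 0\le\alpha_a<m_a\}$ and $\Omega^\alpha=\Omega_1^{\alpha_1}\cdots\Omega_N^{\alpha_N}$.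 $\omega:G_0\to S^1=\{z\in\mathbf C:|z|=1\}$ is a group homomorphism with $\omega(\pm I)=1$; $\omega_a=\omega(\Omega_a)$ and $\omega^\alpha=\omega_1^{\alpha_1}\cdots\omega_N^{\alpha_N}$. $\mathcal D_1=\{X\in\mathfrak g: \bar X=X,\ \Omega X\Omega^{-1}=\omega(\Omega)X\text{ for all }\Omega\in G_0\}$. Lax matrix. $\lambda_1,\dots,\lambda_r$ are non-zero real numbers with $\lambda_1^2,\dots,\lambda_r^2$ distinct, $\kappa$ is a real constant, $\Phi_\sigma=(\phi_{1\sigma},\dots,\phi_{2n,\sigma})^T$ are real column vectors, and $$L(\lambda)=K+\kappa\sum_{\alpha\in\Sigma_0}\sum_{\sigma=1}^r\frac{\Omega^\alpha\Phi_\sigma\Phi_\sigma^T(\Omega^\alpha)^TW}{\lambda-\omega^\alpha\lambda_\sigma}.$$ Poisson bracket on $\mathbf R^{2n\times r}$ (extended complex-bilinearly to complex-valued functions): $\{f,g\}=\sum_{j,k=1}^{2n}\sum_{\sigma=1}^r(W^{-1})_{jk}\frac{\partial f}{\partial\phi_{j\sigma}}\frac{\partial g}{\partial\phi_{k\sigma}}$. *)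

theory Defs
  imports "HOL-Analysis.Analysis" "HOL-Algebra.Multiplicative_Group"
begin

text \<open>
  Square matrices of size \<open>2n\<close> are indexed by a finite type \<open>'m\<close> with \<open>2n\<close> elements; the product is
  always \<open>**\<close>, since \<open>*\<close> and \<open>^\<close> on vectors and matrices act entrywise.
\<close>

abbreviation cmat :: "real^'n^'m \<Rightarrow> complex^'n^'m" where
  "cmat \<equiv> map_matrix complex_of_real"

abbreviation conj_mat :: "complex^'n^'m \<Rightarrow> complex^'n^'m" where
  "conj_mat \<equiv> map_matrix cnj"

definition scale_mat :: "'a::times \<Rightarrow> 'a^'n^'m \<Rightarrow> 'a^'n^'m" where
  "scale_mat c A = map_matrix (\<lambda>x. c * x) A"

primrec mat_pow :: "'a::semiring_1^'m^'m \<Rightarrow> nat \<Rightarrow> 'a^'m^'m" where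
  "mat_pow A 0 = mat 1"
| "mat_pow A (Suc k) = A ** mat_pow A k"

definition commutator :: "'a::ring_1^'m^'m \<Rightarrow> 'a^'m^'m \<Rightarrow> 'a^'m^'m" where
  "commutator A B = A ** B - B ** A"

definition G_grp :: "real^'m^'m \<Rightarrow> (complex^'m^'m) monoid" where
  "G_grp W = \<lparr>carrier = {A. invertible A \<and> transpose A ** cmat W ** A = cmat W},
              mult = (**), one = mat 1\<rparr>"

definition lie_alg :: "real^'m^'m \<Rightarrow> (complex^'m^'m) set" where
  "lie_alg W = {X. transpose X = - (cmat W ** X ** matrix_inv (cmat W))}"

definition PG_grp :: "real^'m^'m \<Rightarrow> (complex^'m^'m) set monoid" where
  "PG_grp W = G_grp W Mod {mat 1, - mat 1}"

definition pr :: "real^'m^'m \<Rightarrow> complex^'m^'m \<Rightarrow> (complex^'m^'m) set" where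
  "pr W A = {mat 1, - mat 1} #>\<^bsub>G_grp W\<^esub> A"

definition circle_grp :: "complex monoid" where
  "circle_grp = \<lparr>carrier = {z. cmod z = 1}, mult = (*), one = 1\<rparr>"

definition D1 :: "real^'m^'m \<Rightarrow> (complex^'m^'m) set \<Rightarrow> (complex^'m^'m \<Rightarrow> complex)
    \<Rightarrow> (complex^'m^'m) set" where
  "D1 W G0 \<omega> = {X \<in> lie_alg W. conj_mat X = X \<and>
     (\<forall>A\<in>G0. A ** X ** matrix_inv A = scale_mat (\<omega> A) X)}"

definition Sigma0 :: "nat \<Rightarrow> (nat \<Rightarrow> nat) \<Rightarrow> (nat \<Rightarrow> nat) set" where
  "Sigma0 N m = (\<Pi>\<^sub>E a\<in>{1..N}. {0..<m a})"

text \<open>The ordered product \<open>\<Omega>\<^sub>1\<^bsup>\<alpha>\<^sub>1\<^esup> \<cdots> \<Omega>\<^sub>N\<^bsup>\<alpha>\<^sub>N\<^esup>\<close>; the factors need not commute.\<close>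

definition Omega_pow :: "nat \<Rightarrow> (nat \<Rightarrow> complex^'m^'m) \<Rightarrow> (nat \<Rightarrow> nat) \<Rightarrow> complex^'m^'m" where
  "Omega_pow N \<Omega> \<alpha> = foldr (\<lambda>a B. mat_pow (\<Omega> a) (\<alpha> a) ** B) [1..<Suc N] (mat 1)"

definition omega_pow :: "nat \<Rightarrow> (nat \<Rightarrow> complex^'m^'m) \<Rightarrow> (complex^'m^'m \<Rightarrow> complex)
    \<Rightarrow> (nat \<Rightarrow> nat) \<Rightarrow> complex" where
  "omega_pow N \<Omega> \<omega> \<alpha> = (\<Prod>a=1..N. \<omega> (\<Omega> a) ^ \<alpha> a)"

definition outer :: "real^'m \<Rightarrow> complex^'m^'m" where
  "outer v = (\<chi> i j. complex_of_real (v $ i * v $ j))"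

text \<open>
  A point of \<open>\<real>\<^bsup>2n\<times>r\<^esup>\<close> is \<open>\<Phi> :: real^'m^'r\<close>; its \<open>\<sigma>\<close>-th column is \<open>\<Phi> $ \<sigma>\<close>, so that
  \<open>\<phi>\<^bsub>j\<sigma>\<^esub>\<close> is \<open>\<Phi> $ \<sigma> $ j\<close>. Division by zero yields zero, hence the value of \<open>Lax\<close> is meaningful
  only for \<open>z \<in> Lax_dom\<close>.
\<close>

definition Lax :: "real^'m^'m \<Rightarrow> nat \<Rightarrow> (nat \<Rightarrow> complex^'m^'m) \<Rightarrow> (nat \<Rightarrow> nat)
    \<Rightarrow> (complex^'m^'m \<Rightarrow> complex) \<Rightarrow> ('r::finite \<Rightarrow> real) \<Rightarrow> real \<Rightarrow> complex^'m^'m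
    \<Rightarrow> complex \<Rightarrow> real^'m^'r \<Rightarrow> complex^'m^'m" where
  "Lax W N \<Omega> m \<omega> lam \<kappa> K z \<Phi> =
     K + scale_mat (complex_of_real \<kappa>) (\<Sum>\<alpha>\<in>Sigma0 N m. \<Sum>\<sigma>\<in>UNIV.
       scale_mat (1 / (z - omega_pow N \<Omega> \<omega> \<alpha> * complex_of_real (lam \<sigma>)))
         (Omega_pow N \<Omega> \<alpha> ** outer (\<Phi> $ \<sigma>) ** transpose (Omega_pow N \<Omega> \<alpha>) ** cmat W))"

definition Lax_dom :: "nat \<Rightarrow> (nat \<Rightarrow> complex^'m^'m) \<Rightarrow> (nat \<Rightarrow> nat)
    \<Rightarrow> (complex^'m^'m \<Rightarrow> complex) \<Rightarrow> ('r::finite \<Rightarrow> real) \<Rightarrow> complex set" where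
  "Lax_dom N \<Omega> m \<omega> lam =
     {z. \<forall>\<alpha>\<in>Sigma0 N m. \<forall>\<sigma>. z \<noteq> omega_pow N \<Omega> \<omega> \<alpha> * complex_of_real (lam \<sigma>)}"

definition pderiv_coord :: "'m::finite \<Rightarrow> 'r::finite \<Rightarrow> (real^'m^'r \<Rightarrow> complex)
    \<Rightarrow> real^'m^'r \<Rightarrow> complex" where
  "pderiv_coord j \<sigma> f \<Phi> =
     vector_derivative (\<lambda>t. f (\<Phi> + t *\<^sub>R axis \<sigma> (axis j 1))) (at 0)"

text \<open>
  Partial derivatives of complex-valued functions of real variables are taken for real and
  imaginary parts separately, so this is the complex-bilinear extension of the real bracket.
\<close>

definition poisson :: "real^'m^'m \<Rightarrow> (real^'m^'r \<Rightarrow> complex) \<Rightarrow> (real^'m^'r::finite \<Rightarrow> complex)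
    \<Rightarrow> real^'m^'r \<Rightarrow> complex" where
  "poisson W f g \<Phi> = (\<Sum>j\<in>UNIV. \<Sum>k\<in>UNIV. \<Sum>\<sigma>\<in>UNIV.
     complex_of_real (matrix_inv W $ j $ k) * pderiv_coord j \<sigma> f \<Phi> * pderiv_coord k \<sigma> g \<Phi>)"

end

theory Submission
  imports Defs
begin

text \<open>
  Write \<open>A\<^sup>*\<close> for the adjoint \<open>W\<^sup>-\<^sup>1 A\<^sup>T W\<close> with respect to the symplectic form, so that
  \<open>L(\<lambda>)\<^sup>* = - L(\<lambda>)\<close>. As \<open>\<theta>\<^sub>1\<close> commutes with \<open>L(\<lambda>)\<close>, the differential of \<open>tr (\<theta>\<^sub>1 L(\<lambda>)\<^sup>k)\<close> is
  \<open>tr (A dL(\<lambda>))\<close> with \<open>A = k \<theta>\<^sub>1 L(\<lambda>)\<^sup>k\<^sup>-\<^sup>1\<close>, and only \<open>A - A\<^sup>*\<close> contributes; this is again of the form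
  \<open>T\<^sub>1 L(\<lambda>)\<^sup>k\<^sup>-\<^sup>1\<close> with \<open>T\<^sub>1\<close> commuting with \<open>L\<close> identically. The bracket becomes a sum over pairs
  \<open>(\<alpha>, \<beta>)\<close>. Since \<open>pr G\<^sub>0\<close> is Abelian, translating \<open>\<beta>\<close> by \<open>\<alpha>\<close> permutes \<open>\<Sigma>\<^sub>0\<close>, and the sum over \<open>\<alpha>\<close> turns into
  \<open>tr ([A, B\<^sub>\<beta>] M)\<close>, where \<open>M\<close> is the divided difference of \<open>L\<close> at \<open>\<lambda>\<close> and \<open>\<mu>\<^sub>\<beta> = \<mu> / \<omega>\<^sup>\<beta>\<close>, and \<open>B\<^sub>\<beta>\<close>, the
  conjugate of \<open>B\<close> by \<open>\<Omega>\<^sup>\<beta>\<close>, commutes with \<open>L(\<mu>\<^sub>\<beta>)\<close>. For \<open>\<lambda> \<noteq> \<mu>\<^sub>\<beta>\<close> this vanishes because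
  \<open>tr ([A, B\<^sub>\<beta>] (L(\<lambda>) - L(\<mu>\<^sub>\<beta>))) = 0\<close>; for \<open>\<lambda> = \<mu>\<^sub>\<beta>\<close> the matrix \<open>M\<close> is a derivative of \<open>L\<close>, which also
  commutes with the constant matrices.
\<close>

section \<open>Matrices\<close>

lemma scale_mat_nth [simp]: "scale_mat c A $ i $ j = c * A $ i $ j"
  by (simp add: scale_mat_def)

lemma matrix_add_rdistrib: "(A + B) ** C = A ** C + B ** C"
  for A B :: "'a::semiring_1^'n^'m" and C :: "'a^'k^'n"
  by (vector matrix_matrix_mult_def sum.distrib[symmetric] field_simps)

lemma matrix_diff_ldistrib: "A ** (B - C) = A ** B - A ** C"
  for A :: "'a::ring_1^'n^'m" and B C :: "'a^'k^'n"
  by (vector matrix_matrix_mult_def sum_subtractf[symmetric] right_diff_distrib)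

lemma matrix_diff_rdistrib: "(A - B) ** C = A ** C - B ** C"
  for A B :: "'a::ring_1^'n^'m" and C :: "'a^'k^'n"
  by (vector matrix_matrix_mult_def sum_subtractf[symmetric] left_diff_distrib)

lemma matrix_minus_left [simp]: "(- A) ** B = - (A ** B)"
  for A :: "'a::ring_1^'n^'m" and B :: "'a^'k^'n"
  by (vector matrix_matrix_mult_def sum_negf[symmetric])

lemma matrix_minus_right [simp]: "A ** (- B) = - (A ** B)"
  for A :: "'a::ring_1^'n^'m" and B :: "'a^'k^'n"
  by (vector matrix_matrix_mult_def sum_negf[symmetric])

lemma matrix_zero_left [simp]: "0 ** B = 0" and matrix_zero_right [simp]: "A ** 0 = 0"
  for A :: "'a::semiring_1^'n^'m" and B :: "'a^'k^'n"
  by (simp_all add: matrix_matrix_mult_def vec_eq_iff)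

lemma matrix_sum_right: "A ** (\<Sum>i\<in>I. f i) = (\<Sum>i\<in>I. A ** f i)"
  for A :: "'a::semiring_1^'n^'m" and f :: "'i \<Rightarrow> 'a^'k^'n"
  by (induction I rule: infinite_finite_induct) (simp_all add: matrix_add_ldistrib)

lemma matrix_sum_left: "(\<Sum>i\<in>I. f i) ** A = (\<Sum>i\<in>I. f i ** A)"
  for A :: "'a::semiring_1^'n^'m" and f :: "'i \<Rightarrow> 'a^'m^'k"
  by (induction I rule: infinite_finite_induct) (simp_all add: matrix_add_rdistrib)

lemma scale_mat_mult_left [simp]: "scale_mat c A ** B = scale_mat c (A ** B)"
  for A :: "'a::comm_semiring_1^'n^'m" and B :: "'a^'k^'n"
  by (simp add: matrix_matrix_mult_def vec_eq_iff sum_distrib_left mult.assoc)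

lemma scale_mat_mult_right [simp]: "A ** scale_mat c B = scale_mat c (A ** B)"
  for A :: "'a::comm_semiring_1^'n^'m" and B :: "'a^'k^'n"
  by (simp add: matrix_matrix_mult_def vec_eq_iff sum_distrib_left mult.left_commute)

lemma scale_mat_scale_mat [simp]: "scale_mat c (scale_mat d A) = scale_mat (c * d) A"
  for c :: "'a::semigroup_mult"
  by (simp add: vec_eq_iff mult.assoc)

lemma scale_mat_one [simp]: "scale_mat 1 A = A" for A :: "'a::monoid_mult^'n^'m"
  by (simp add: vec_eq_iff)

lemma scale_mat_zero [simp]: "scale_mat c 0 = (0 :: 'a^'n^'m)"
  for c :: "'a::semiring_1"
  by (simp add: vec_eq_iff)

lemma scale_mat_add: "scale_mat c (A + B) = scale_mat c A + scale_mat c B"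
  for c :: "'a::semiring_1"
  by (simp add: vec_eq_iff distrib_left)

lemma scale_mat_diff: "scale_mat c (A - B) = scale_mat c A - scale_mat c B"
  for c :: "'a::ring_1"
  by (simp add: vec_eq_iff right_diff_distrib)

lemma scale_mat_minus [simp]: "scale_mat c (- A) = - scale_mat c A" for c :: "'a::ring_1"
  by (simp add: vec_eq_iff)

lemma scale_mat_sum: "scale_mat c (\<Sum>i\<in>I. f i) = (\<Sum>i\<in>I. scale_mat c (f i))"
  for c :: "'a::semiring_1"
  by (induction I rule: infinite_finite_induct) (simp_all add: scale_mat_add)

lemma transpose_scale_mat [simp]: "transpose (scale_mat c A) = scale_mat c (transpose A)"
  by (simp add: transpose_def vec_eq_iff)

lemma transpose_minus [simp]: "transpose (- A) = - transpose A" for A :: "'a::ring_1^'n^'m"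
  by (simp add: transpose_def vec_eq_iff)

lemma transpose_add: "transpose (A + B) = transpose A + transpose B"
  for A :: "'a::ring_1^'n^'m"
  by (simp add: transpose_def vec_eq_iff)

lemma transpose_diff: "transpose (A - B) = transpose A - transpose B"
  for A :: "'a::ring_1^'n^'m"
  by (simp add: transpose_def vec_eq_iff)

lemma transpose_sum: "transpose (\<Sum>i\<in>I. f i) = (\<Sum>i\<in>I. transpose (f i))"
  for f :: "'i \<Rightarrow> 'a::ring_1^'n^'m"
  by (simp add: transpose_def vec_eq_iff)

lemma trace_scale_mat [simp]: "trace (scale_mat c A) = c * trace A" for c :: "'a::comm_semiring_1"
  by (simp add: trace_def sum_distrib_left)

lemma trace_minus [simp]: "trace (- A) = - trace A" for A :: "'a::comm_ring_1^'n^'n"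
  by (simp add: trace_def sum_negf)

lemma trace_sum: "trace (\<Sum>i\<in>I. f i) = (\<Sum>i\<in>I. trace (f i))"
  for f :: "'i \<Rightarrow> 'a::comm_ring_1^'n^'n"
  by (simp add: trace_def sum.swap[of _ I])

lemma trace_transpose [simp]: "trace (transpose A) = trace A"
  by (simp add: trace_def transpose_def)

section \<open>Matrix powers and cyclicity of the trace\<close>

lemma mat_pow_commute:
  "A ** B = B ** A \<Longrightarrow> A ** mat_pow B k = mat_pow B k ** A"
  by (induction k) (simp, metis mat_pow.simps(2) matrix_mul_assoc)

lemma mat_pow_Suc_right: "mat_pow A (Suc k) = mat_pow A k ** A"
  by (simp add: mat_pow_commute)

lemma mat_pow_add: "mat_pow A (k + l) = mat_pow A k ** mat_pow A l"
  by (induction k) (simp_all add: matrix_mul_assoc)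

lemma mat_pow_scale_mat: "mat_pow (scale_mat c A) k = scale_mat (c ^ k) (mat_pow A k)"
  for c :: "'a::comm_semiring_1"
  by (induction k) (simp_all add: mult.commute)

lemma mat_pow_conjugate:
  fixes U V A :: "'a::semiring_1^'n^'n"
  assumes "U ** V = mat 1" and "V ** U = mat 1"
  shows "mat_pow (V ** A ** U) k = V ** mat_pow A k ** U"
proof (induction k)
  case 0
  show ?case using assms by simp
next
  case (Suc k)
  have "V ** A ** U ** (V ** X ** U) = V ** (A ** X) ** U" for X
    by (metis assms(1) matrix_mul_assoc matrix_mul_rid)
  with Suc show ?case by simp
qed

text \<open>By cyclicity and the assumption, both sides equal the trace of
  \<open>X ** Y ** T\<close>.\<close>

lemma trace_mult_swap:
  fixes T X Y :: "'a::comm_ring_1^'n^'n"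
  assumes "T ** Y = Y ** T"
  shows "trace (T ** X ** Y) = trace (X ** T ** Y)"
  by (metis assms matrix_mul_assoc trace_mul_sym)

text \<open>Under the trace against \<open>L\<close> the factors of \<open>A ** B\<close> may be
  exchanged because \<open>A\<close> commutes with \<open>L\<close>; against \<open>L'\<close> they
  may be exchanged because \<open>B\<close> commutes with \<open>L'\<close>.\<close>

lemma trace_commutator_eq_0:
  fixes A B L L' :: "'a::comm_ring_1^'n^'n"
  assumes "A ** L = L ** A" and "B ** L' = L' ** B"
  shows "trace ((A ** B - B ** A) ** (L - L')) = 0"
proof -
  have "trace (A ** B ** L) = trace (B ** A ** L)"
    using assms(1) by (rule trace_mult_swap)
  moreover have "trace (B ** A ** L') = trace (A ** B ** L')"
    using assms(2) by (rule trace_mult_swap)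
  ultimately show ?thesis
    by (simp add: matrix_diff_ldistrib matrix_diff_rdistrib trace_sub)
qed

section \<open>Differentiation of traces of matrix powers\<close>

lemma bounded_linear_scale_mat: "bounded_linear (scale_mat c :: complex^'n^'m \<Rightarrow> complex^'n^'m)"
proof -
  have "linear (scale_mat c :: complex^'n^'m \<Rightarrow> complex^'n^'m)"
    by (rule linearI) (simp_all add: scale_mat_add vec_eq_iff)
  then show ?thesis by (simp add: linear_conv_bounded_linear)
qed

lemma bounded_linear_trace: "bounded_linear (trace :: complex^'n^'n \<Rightarrow> complex)"
proof -
  have "linear (trace :: complex^'n^'n \<Rightarrow> complex)"
    by (rule linearI) (simp_all add: trace_def sum.distrib scaleR_sum_right)
  then show ?thesis by (simp add: linear_conv_bounded_linear)
qed

lemma bounded_bilinear_matrix_mult: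
  "bounded_bilinear ((**) :: complex^'n^'m \<Rightarrow> complex^'k^'n \<Rightarrow> complex^'k^'m)"
proof -
  have "linear ((**) A :: complex^'k^'n \<Rightarrow> complex^'k^'m)" for A
    by (rule linearI) (simp_all add: vec_eq_iff matrix_matrix_mult_def scaleR_sum_right
        distrib_left sum.distrib)
  moreover have "linear (\<lambda>A :: complex^'n^'m. A ** B)" for B :: "complex^'k^'n"
    by (rule linearI) (simp_all add: vec_eq_iff matrix_matrix_mult_def scaleR_sum_right
        distrib_right sum.distrib)
  ultimately show ?thesis
    by (subst bilinear_conv_bounded_bilinear[symmetric]) (simp add: bilinear_def)
qed

text \<open>The derivative of a power is a sum of \<open>k\<close> terms with \<open>D\<close> in
  different positions. Only its trace against matrices commuting with \<open>M x\<close> is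
  recorded, where cyclicity makes all terms equal. Quantifying over \<open>X\<close> inside the
  existential lets the induction change \<open>X\<close>. At \<open>k = 0\<close> the truncated
  \<open>k - 1\<close> does no harm, as \<open>of_nat k\<close> vanishes.\<close>

lemma mat_pow_has_vector_derivative:
  fixes M :: "real \<Rightarrow> complex^'n^'n"
  assumes M: "(M has_vector_derivative D) (at x)"
  shows "\<exists>D'. ((\<lambda>t. mat_pow (M t) k) has_vector_derivative D') (at x) \<and>
    (\<forall>X. X ** M x = M x ** X \<longrightarrow> trace (X ** D') = of_nat k * trace (X ** mat_pow (M x) (k - 1) ** D))"
proof (induction k)
  case 0
  show ?case by (intro exI[of _ 0]) (simp add: trace_def)
next
  case (Suc k)
  then obtain D' where D': "((\<lambda>t. mat_pow (M t) k) has_vector_derivative D') (at x)"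
    and tr: "X ** M x = M x ** X \<Longrightarrow> trace (X ** D') = of_nat k * trace (X ** mat_pow (M x) (k - 1) ** D)" for X
    by blast
  have "((\<lambda>t. M t ** mat_pow (M t) k) has_vector_derivative (M x ** D' + D ** mat_pow (M x) k)) (at x)"
    using bounded_bilinear.has_vector_derivative[OF bounded_bilinear_matrix_mult M D'] .
  moreover have "trace (X ** (M x ** D' + D ** mat_pow (M x) k))
      = of_nat (Suc k) * trace (X ** mat_pow (M x) k ** D)"
    if X: "X ** M x = M x ** X" for X
  proof -
    have "trace (X ** (D ** mat_pow (M x) k)) = trace (X ** mat_pow (M x) k ** D)"
      by (metis X mat_pow_commute matrix_mul_assoc trace_mul_sym)
    \<comment> \<open>The induction hypothesis is applied to \<open>X ** M x\<close>, which again
      commutes with \<open>M x\<close>.\<close>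
    moreover have "trace (X ** (M x ** D')) = of_nat k * trace (X ** mat_pow (M x) k ** D)"
    proof -
      have "X ** M x ** M x = M x ** (X ** M x)"
        by (metis X matrix_mul_assoc)
      from tr[OF this] show ?thesis
        by (cases k) (simp_all add: matrix_mul_assoc)
    qed
    ultimately show ?thesis
      by (simp add: matrix_add_ldistrib trace_add algebra_simps)
  qed
  ultimately show ?case by (intro exI[of _ "M x ** D' + D ** mat_pow (M x) k"]) simp
qed

lemma trace_mat_pow_has_vector_derivative:
  fixes M :: "real \<Rightarrow> complex^'n^'n"
  assumes "(M has_vector_derivative D) (at x)" and "X ** M x = M x ** X"
  shows "((\<lambda>t. trace (X ** mat_pow (M t) k)) has_vector_derivative
    of_nat k * trace (X ** mat_pow (M x) (k - 1) ** D)) (at x)"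
proof -
  obtain D' where D': "((\<lambda>t. mat_pow (M t) k) has_vector_derivative D') (at x)"
    and "trace (X ** D') = of_nat k * trace (X ** mat_pow (M x) (k - 1) ** D)"
    using mat_pow_has_vector_derivative[OF assms(1)] assms(2) by blast
  moreover have "((\<lambda>t. trace (X ** mat_pow (M t) k)) has_vector_derivative trace (X ** D')) (at x)"
    by (intro bounded_linear.has_vector_derivative[OF bounded_linear_trace]
        bounded_linear.has_vector_derivative[OF bounded_bilinear.bounded_linear_right[OF bounded_bilinear_matrix_mult]] D')
  ultimately show ?thesis by simp
qed

section \<open>Commutators, inverses and entrywise maps\<close>

lemma commutator_scale_mat [simp]:
  "commutator (scale_mat c A) B = scale_mat c (commutator A B)"
  "commutator A (scale_mat c B) = scale_mat c (commutator A B)"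
  for c :: "'a::comm_ring_1"
  by (simp_all add: commutator_def scale_mat_diff)

lemma commutator_sum:
  "commutator (\<Sum>i\<in>I. f i) B = (\<Sum>i\<in>I. commutator (f i) B)"
  "commutator A (\<Sum>i\<in>I. f i) = (\<Sum>i\<in>I. commutator A (f i))"
  by (simp_all add: commutator_def matrix_sum_left matrix_sum_right sum_subtractf)

lemma commutator_conjugate:
  assumes "U ** V = mat 1"
  shows "commutator (V ** A ** U) (V ** B ** U) = V ** commutator A B ** U"
proof -
  have "V ** A ** U ** (V ** B ** U) = V ** (A ** B) ** U" for A B
    by (metis assms matrix_mul_assoc matrix_mul_rid)
  then show ?thesis by (simp add: commutator_def matrix_diff_ldistrib matrix_diff_rdistrib)
qed

lemma matrix_inv_mult:
  assumes "invertible A"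
  shows "A ** matrix_inv A = mat 1" and "matrix_inv A ** A = mat 1"
  using assms unfolding invertible_def matrix_inv_def by (metis (mono_tags, lifting) someI_ex)+

lemma matrix_inv_eqI:
  fixes A B :: "'a::semiring_1^'n^'n"
  assumes "A ** B = mat 1" and "B ** A = mat 1"
  shows "matrix_inv A = B"
proof -
  have "invertible A" using assms by (auto simp: invertible_def)
  then show ?thesis
    by (metis assms(2) matrix_inv_mult(1) matrix_mul_assoc matrix_mul_lid matrix_mul_rid)
qed

lemma cmat_mult: "cmat (A ** B) = cmat A ** cmat B"
  by (simp add: matrix_matrix_mult_def vec_eq_iff)

lemma cmat_mat_1 [simp]: "cmat (mat 1) = mat 1"
  by (simp add: mat_def vec_eq_iff)

lemma conj_mat_mult: "conj_mat (A ** B) = conj_mat A ** conj_mat B"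
  by (simp add: matrix_matrix_mult_def vec_eq_iff)

section \<open>Rank-one matrices and quadratic forms\<close>

definition outer_deriv :: "'m \<Rightarrow> real^'m \<Rightarrow> complex^'m^'m" where
  "outer_deriv j v = (\<chi> a b. complex_of_real (axis j 1 $ a * v $ b + v $ a * axis j 1 $ b))"

text \<open>\<open>outer\<close> is quadratic, so its expansion in \<open>t\<close> is exact: the
  linear coefficient e_j v^T + v e_j^T is \<open>outer_deriv j v\<close>, and the remainder is a
  multiple of t^2.\<close>

lemma outer_has_vector_derivative:
  fixes v :: "real^'m"
  shows "((\<lambda>t. outer (v + t *\<^sub>R axis j 1)) has_vector_derivative outer_deriv j v) (at 0)"
proof -
  let ?e = "axis j 1 :: real^'m"
  have *: "outer (v + t *\<^sub>R ?e) = outer v + t *\<^sub>R outer_deriv j v + t\<^sup>2 *\<^sub>R outer ?e" for t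
    by (simp add: vec_eq_iff outer_def outer_deriv_def scaleR_conv_of_real[where 'a = complex] algebra_simps power2_eq_square)
  have "((\<lambda>t. outer v + t *\<^sub>R outer_deriv j v + t\<^sup>2 *\<^sub>R outer ?e) has_vector_derivative
      (outer_deriv j v)) (at 0)"
    by (auto intro!: derivative_eq_intros simp: has_vector_derivative_def has_field_derivative_def)
  then show ?thesis by (simp only: *)
qed

lemma transpose_outer [simp]: "transpose (outer v) = outer v"
  by (simp add: outer_def transpose_def vec_eq_iff mult.commute)

text \<open>The variation of a symmetric matrix detects only the symmetric part of \<open>X\<close>;
  this is where antisymmetrisation with respect to \<open>adj\<close> will come from.\<close>

lemma trace_mult_outer_deriv:
  "trace (X ** outer_deriv j v) = ((X + transpose X) *v (\<chi> i. complex_of_real (v $ i))) $ j"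
proof -
  have "trace (X ** outer_deriv j v) = (\<Sum>a\<in>UNIV. \<Sum>b\<in>UNIV.
      X $ a $ b * (of_real (axis j 1 $ b) * of_real (v $ a)) + X $ a $ b * (of_real (v $ b) * of_real (axis j 1 $ a)))"
    by (simp add: trace_def matrix_matrix_mult_def outer_deriv_def distrib_left)
  also have "\<dots> = (\<Sum>a\<in>UNIV. X $ a $ j * of_real (v $ a)) + (\<Sum>b\<in>UNIV. X $ j $ b * of_real (v $ b))"
  proof -
    have "(\<Sum>b\<in>UNIV. X $ a $ b * (of_real (axis j 1 $ b) * of_real (v $ a))) = X $ a $ j * of_real (v $ a)" for a
      by (subst sum.remove[of _ j]) (auto simp: axis_def intro!: sum.neutral)
    moreover have "(\<Sum>a\<in>UNIV. \<Sum>b\<in>UNIV. X $ a $ b * (of_real (v $ b) * of_real (axis j 1 $ a)))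
        = (\<Sum>b\<in>UNIV. X $ j $ b * of_real (v $ b))"
      by (subst sum.remove[of _ j]) (auto simp: axis_def intro!: sum.neutral)
    ultimately show ?thesis by (simp add: sum.distrib)
  qed
  also have "\<dots> = ((X + transpose X) *v (\<chi> i. complex_of_real (v $ i))) $ j"
    by (simp add: matrix_vector_mult_def transpose_def distrib_right sum.distrib add.commute)
  finally show ?thesis .
qed

text \<open>Turns the double sum of the bracket, for gradients linear in the coordinates, into a
  trace. The link is that the quadratic form of \<open>X\<close> at \<open>x\<close> equals the
  trace of \<open>X ** outer v\<close>.\<close>

lemma bilinear_form_outer:
  fixes F A G :: "complex^'m^'m" and v :: "real^'m"
  defines "x \<equiv> \<chi> i. complex_of_real (v $ i)"
  shows "(\<Sum>j\<in>UNIV. \<Sum>k\<in>UNIV. A $ j $ k * (F *v x) $ j * (G *v x) $ k)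
    = trace (transpose F ** A ** G ** outer v)"
proof -
  have "trace (X ** outer v) = (\<Sum>a\<in>UNIV. x $ a * (X *v x) $ a)" for X
    by (simp add: trace_def matrix_matrix_mult_def matrix_vector_mult_def outer_def x_def
        sum_distrib_left mult_ac)
  then have "trace (transpose F ** A ** G ** outer v)
      = (\<Sum>a\<in>UNIV. x $ a * (transpose F *v (A *v (G *v x))) $ a)"
    by (simp add: matrix_vector_mul_assoc[symmetric] del: transpose_matrix_vector)
  also have "\<dots> = (\<Sum>a\<in>UNIV. \<Sum>j\<in>UNIV. x $ a * (F $ j $ a * (A *v (G *v x)) $ j))"
  proof -
    have "(transpose F *v y) $ a = (\<Sum>j\<in>UNIV. F $ j $ a * y $ j)" for y a
      by (simp add: matrix_vector_mult_def transpose_def del: transpose_matrix_vector)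
    then show ?thesis by (simp add: sum_distrib_left del: transpose_matrix_vector)
  qed
  also have "\<dots> = (\<Sum>j\<in>UNIV. \<Sum>a\<in>UNIV. x $ a * (F $ j $ a * (A *v (G *v x)) $ j))"
    by (rule sum.swap)
  also have "\<dots> = (\<Sum>j\<in>UNIV. (F *v x) $ j * (A *v (G *v x)) $ j)"
    by (simp add: matrix_vector_mult_def[of F] sum_distrib_left sum_distrib_right mult_ac)
  also have "\<dots> = (\<Sum>j\<in>UNIV. \<Sum>k\<in>UNIV. A $ j $ k * (F *v x) $ j * (G *v x) $ k)"
    by (simp add: matrix_vector_mult_def[of A] sum_distrib_left mult_ac)
  finally show ?thesis by simp
qed

section \<open>Lax matrices twisted by a finite family\<close>

text \<open>What the computation uses, freed from groups and orders: \<open>S\<close> stands for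
  \<Sigma>_0, and \<open>U\<close>, \<open>u\<close> for the families \<Omega>^\<alpha>,
  \<omega>^\<alpha>. In \<open>shift\<close>, translation by \<open>s\<close> permutes
  \<open>S\<close>. Products are controlled only modulo sign, so each order of the two factors gets
  its own sign.\<close>

locale lax_system =
  fixes W Wi :: "complex^'m^'m" and S :: "'i set" and U :: "'i \<Rightarrow> complex^'m^'m"
    and u :: "'i \<Rightarrow> complex" and lam :: "'r::finite \<Rightarrow> complex" and \<kappa> :: complex
    and K :: "complex^'m^'m"
  assumes W_Wi: "W ** Wi = mat 1" and Wi_W: "Wi ** W = mat 1"
    and W_antisym: "transpose W = - W"
    and finite_S: "finite S"
    and U_W: "s \<in> S \<Longrightarrow> transpose (U s) ** W ** U s = W"
    and u_nonzero: "s \<in> S \<Longrightarrow> u s \<noteq> 0"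
    and K_lie: "Wi ** transpose K ** W = - K"
    and K_twist: "s \<in> S \<Longrightarrow> U s ** K = scale_mat (u s) (K ** U s)"
    and shift: "s \<in> S \<Longrightarrow> \<exists>\<pi>. bij_betw \<pi> S S \<and> (\<forall>t\<in>S. u (\<pi> t) = u s * u t \<and>
      (U (\<pi> t) = U s ** U t \<or> U (\<pi> t) = - (U s ** U t)) \<and>
      (U (\<pi> t) = U t ** U s \<or> U (\<pi> t) = - (U t ** U s)))"
begin

definition lax :: "complex \<Rightarrow> real^'m^'r \<Rightarrow> complex^'m^'m" where
  "lax z \<Phi> = K + scale_mat \<kappa> (\<Sum>s\<in>S. \<Sum>\<sigma>\<in>UNIV.
    scale_mat (1 / (z - u s * lam \<sigma>)) (U s ** outer (\<Phi> $ \<sigma>) ** transpose (U s) ** W))"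

definition dom :: "complex set" where
  "dom = {z. \<forall>s\<in>S. \<forall>\<sigma>. z \<noteq> u s * lam \<sigma>}"

text \<open>An anti-involution that inverts every \<open>U s\<close> and is -1 on the Lie algebra,
  so conjugation by \<open>U s\<close> needs no inverses.\<close>

definition adj :: "complex^'m^'m \<Rightarrow> complex^'m^'m" where
  "adj A = Wi ** transpose A ** W"

definition P :: "real^'m^'r \<Rightarrow> 'r \<Rightarrow> complex^'m^'m" where
  "P \<Phi> \<sigma> = outer (\<Phi> $ \<sigma>) ** W"

text \<open>Up to \<kappa>, the coefficient of the pole term at \<open>u s * lam \<sigma>\<close>:
  the untwisted \<open>P\<close> conjugated by \<open>U s\<close>.\<close>

definition Q :: "real^'m^'r \<Rightarrow> 'i \<Rightarrow> 'r \<Rightarrow> complex^'m^'m" where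
  "Q \<Phi> s \<sigma> = U s ** P \<Phi> \<sigma> ** adj (U s)"

section \<open>The adjoint with respect to the symplectic form\<close>

lemma W_Wi_cancel [simp]: "A ** W ** Wi = A" "A ** Wi ** W = A"
  by (metis W_Wi matrix_mul_assoc matrix_mul_rid, metis Wi_W matrix_mul_assoc matrix_mul_rid)

lemma Wi_antisym: "transpose Wi = - Wi"
proof -
  have "transpose Wi ** transpose W = mat 1"
    by (metis W_Wi matrix_transpose_mul transpose_mat)
  then have "- (transpose Wi) ** W = mat 1" by (simp add: W_antisym)
  then have "- transpose Wi = Wi"
    by (metis W_Wi matrix_mul_assoc matrix_mul_lid matrix_mul_rid)
  then show ?thesis by (metis minus_minus)
qed

lemma adj_mult: "adj (A ** B) = adj B ** adj A"
  by (simp add: adj_def matrix_transpose_mul matrix_mul_assoc)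

lemma adj_add: "adj (A + B) = adj A + adj B"
  by (simp add: adj_def transpose_add matrix_add_ldistrib matrix_add_rdistrib)

lemma adj_diff: "adj (A - B) = adj A - adj B"
  by (simp add: adj_def transpose_diff matrix_diff_ldistrib matrix_diff_rdistrib)

lemma adj_minus [simp]: "adj (- A) = - adj A"
  by (simp add: adj_def)

lemma adj_sum: "adj (\<Sum>i\<in>I. f i) = (\<Sum>i\<in>I. adj (f i))"
  by (simp add: adj_def transpose_sum matrix_sum_left matrix_sum_right)

lemma adj_scale_mat [simp]: "adj (scale_mat c A) = scale_mat c (adj A)"
  by (simp add: adj_def)

lemma adj_adj [simp]: "adj (adj A) = A"
  by (simp add: adj_def matrix_transpose_mul W_antisym Wi_antisym matrix_mul_assoc Wi_W)

lemma adj_mat_1 [simp]: "adj (mat 1) = mat 1"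
  by (simp add: adj_def Wi_W)

lemma trace_adj: "trace (adj A) = trace A"
proof -
  have "trace (adj A) = trace (W ** (Wi ** transpose A))"
    unfolding adj_def by (rule trace_mul_sym)
  then show ?thesis by (simp add: matrix_mul_assoc W_Wi)
qed

lemma W_adj: "W ** adj A = transpose A ** W"
  by (simp add: adj_def matrix_mul_assoc W_Wi)

lemma adj_mat_pow: "adj (mat_pow A k) = mat_pow (adj A) k"
proof (induction k)
  case (Suc k)
  then show ?case by (simp add: adj_mult mat_pow_commute)
qed simp

lemma adj_U_mult [simp]: "s \<in> S \<Longrightarrow> adj (U s) ** U s = mat 1"
  by (metis U_W Wi_W adj_def matrix_mul_assoc)

lemma U_mult_adj [simp]: "s \<in> S \<Longrightarrow> U s ** adj (U s) = mat 1"
  using adj_U_mult matrix_left_right_inverse by blast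

lemma U_cancel [simp]:
  assumes "s \<in> S"
  shows "A ** U s ** adj (U s) = A" "A ** adj (U s) ** U s = A"
  by (metis U_mult_adj assms matrix_mul_assoc matrix_mul_rid)
     (metis adj_U_mult assms matrix_mul_assoc matrix_mul_rid)

lemma adj_P: "adj (P \<Phi> \<sigma>) = - P \<Phi> \<sigma>"
  by (simp add: adj_def P_def matrix_transpose_mul W_antisym matrix_mul_assoc Wi_W)

text \<open>\<open>W_adj\<close> trades the transpose of \<open>U s\<close> for its adjoint,
  exhibiting each pole coefficient as a conjugate.\<close>

lemma lax_alt:
  "lax z \<Phi> = K + scale_mat \<kappa> (\<Sum>s\<in>S. \<Sum>\<sigma>\<in>UNIV. scale_mat (1 / (z - u s * lam \<sigma>)) (Q \<Phi> s \<sigma>))"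
proof -
  have "U s ** outer (\<Phi> $ \<sigma>) ** transpose (U s) ** W = Q \<Phi> s \<sigma>" for s \<sigma>
    by (simp add: Q_def P_def W_adj matrix_mul_assoc[symmetric])
  then show ?thesis by (simp add: lax_def)
qed

lemma adj_Q: "adj (Q \<Phi> s \<sigma>) = - Q \<Phi> s \<sigma>"
  by (simp add: Q_def adj_mult adj_P matrix_mul_assoc)

lemma adj_lax: "adj (lax z \<Phi>) = - lax z \<Phi>"
proof -
  have "adj K = - K" using K_lie by (simp add: adj_def)
  then show ?thesis
    by (simp add: lax_alt adj_add adj_sum adj_Q sum_negf)
qed

section \<open>Twisting symmetry of the Lax matrix\<close>

lemma Q_shift:
  assumes "U t' = U s ** U t \<or> U t' = - (U s ** U t)"
  shows "Q \<Phi> t' \<sigma> = U s ** Q \<Phi> t \<sigma> ** adj (U s)"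
  \<comment> \<open>The sign of \<open>U t'\<close> enters twice, through \<open>U t'\<close> and
    its adjoint, and cancels.\<close>
  using assms by (auto simp: Q_def adj_mult matrix_mul_assoc)

text \<open>Multiplication by \<open>u s\<close> permutes the poles. Surjectivity of \<pi> gives the
  statement for the product, and \<pi> mapping \<open>S\<close> into itself gives it for the
  quotient.\<close>

lemma dom_shift:
  assumes "s \<in> S" "z \<in> dom"
  shows "u s * z \<in> dom" and "z / u s \<in> dom"
proof -
  obtain \<pi> where bij: "bij_betw \<pi> S S" and \<pi>: "\<And>t. t \<in> S \<Longrightarrow> u (\<pi> t) = u s * u t"
    using shift[OF assms(1)] by blast
  have "u s * z \<noteq> u t * lam \<sigma>" if "t \<in> S" for t \<sigma>
  proof -
    obtain t' where "t' \<in> S" "t = \<pi> t'" using bij \<open>t \<in> S\<close> by (auto simp: bij_betw_def)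
    then show ?thesis using \<pi> u_nonzero[OF assms(1)] assms(2) by (auto simp: dom_def)
  qed
  then show "u s * z \<in> dom" by (simp add: dom_def)
  have "z / u s \<noteq> u t * lam \<sigma>" if "t \<in> S" for t \<sigma>
  proof
    assume "z / u s = u t * lam \<sigma>"
    then have "z = u (\<pi> t) * lam \<sigma>"
      using \<pi>[OF that] u_nonzero[OF assms(1)] by (simp add: field_simps)
    moreover have "\<pi> t \<in> S" using bij that by (auto simp: bij_betw_def)
    ultimately show False using assms(2) by (auto simp: dom_def)
  qed
  then show "z / u s \<in> dom" by (simp add: dom_def)
qed

text \<open>Conjugation by \<open>U s\<close> carries the pole coefficient of \<open>t\<close> to
  that of \<pi> t, and 1 / (z - a) = c / (c z - c a) with c = \<open>u s\<close> adjusts the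
  weights; reindexing along \<pi> restores the sum.\<close>

lemma lax_shift:
  assumes s: "s \<in> S"
  shows "U s ** lax z \<Phi> ** adj (U s) = scale_mat (u s) (lax (u s * z) \<Phi>)"
proof -
  obtain \<pi> where bij: "bij_betw \<pi> S S" and \<pi>: "\<And>t. t \<in> S \<Longrightarrow> u (\<pi> t) = u s * u t"
    and U\<pi>: "\<And>t. t \<in> S \<Longrightarrow> U (\<pi> t) = U s ** U t \<or> U (\<pi> t) = - (U s ** U t)"
    using shift[OF s] by blast
  have "U s ** lax z \<Phi> ** adj (U s) = scale_mat (u s) K +
      scale_mat \<kappa> (\<Sum>t\<in>S. \<Sum>\<sigma>\<in>UNIV. scale_mat (1 / (z - u t * lam \<sigma>)) (U s ** Q \<Phi> t \<sigma> ** adj (U s)))"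
    using s by (simp add: lax_alt matrix_add_ldistrib matrix_add_rdistrib K_twist matrix_sum_left
        matrix_sum_right)
  also have "(\<Sum>t\<in>S. \<Sum>\<sigma>\<in>UNIV. scale_mat (1 / (z - u t * lam \<sigma>)) (U s ** Q \<Phi> t \<sigma> ** adj (U s)))
      = (\<Sum>t\<in>S. \<Sum>\<sigma>\<in>UNIV. scale_mat (u s * (1 / (u s * z - u (\<pi> t) * lam \<sigma>))) (Q \<Phi> (\<pi> t) \<sigma>))"
  proof (intro sum.cong refl)
    fix t \<sigma> assume t: "t \<in> S"
    have "1 / (z - u t * lam \<sigma>) = u s * (1 / (u s * z - u (\<pi> t) * lam \<sigma>))"
    proof -
      have "u s * z - u (\<pi> t) * lam \<sigma> = u s * (z - u t * lam \<sigma>)"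
        by (simp add: \<pi>[OF t] algebra_simps)
      then show ?thesis using u_nonzero[OF s] by simp
    qed
    moreover have "U s ** Q \<Phi> t \<sigma> ** adj (U s) = Q \<Phi> (\<pi> t) \<sigma>"
      using Q_shift[OF U\<pi>[OF t]] by simp
    ultimately show "scale_mat (1 / (z - u t * lam \<sigma>)) (U s ** Q \<Phi> t \<sigma> ** adj (U s))
        = scale_mat (u s * (1 / (u s * z - u (\<pi> t) * lam \<sigma>))) (Q \<Phi> (\<pi> t) \<sigma>)" by simp
  qed
  also have "\<dots> = (\<Sum>t\<in>S. \<Sum>\<sigma>\<in>UNIV. scale_mat (u s * (1 / (u s * z - u t * lam \<sigma>))) (Q \<Phi> t \<sigma>))"
    by (rule sum.reindex_bij_betw[OF bij])
  finally show ?thesis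
    by (simp add: lax_alt scale_mat_add scale_mat_sum mult_ac)
qed

lemma lax_shift':
  assumes s: "s \<in> S"
  shows "adj (U s) ** lax z \<Phi> ** U s = scale_mat (1 / u s) (lax (z / u s) \<Phi>)"
proof -
  have "scale_mat (1 / u s) (adj (U s) ** (U s ** lax (z / u s) \<Phi> ** adj (U s)) ** U s)
      = adj (U s) ** lax z \<Phi> ** U s"
    unfolding lax_shift[OF s] using u_nonzero[OF s] by simp
  moreover have "adj (U s) ** (U s ** X ** adj (U s)) ** U s = X" for X
    using s by (simp add: matrix_mul_assoc)
  ultimately show ?thesis by simp
qed

section \<open>Divided differences and vanishing commutator traces\<close>

definition lax_quot :: "complex \<Rightarrow> complex \<Rightarrow> real^'m^'r \<Rightarrow> complex^'m^'m" where
  "lax_quot z w \<Phi> = scale_mat \<kappa> (\<Sum>s\<in>S. \<Sum>\<sigma>\<in>UNIV.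
    scale_mat (1 / ((z - u s * lam \<sigma>) * (w - u s * lam \<sigma>))) (Q \<Phi> s \<sigma>))"

text \<open>Partial fractions identify \<open>lax_quot\<close> as the divided difference (L(z) -
  L(w)) / (w - z). Its explicit form stays meaningful at \<open>w = z\<close>, where it is minus the
  derivative of L.\<close>

lemma lax_quot_eq:
  assumes "z \<in> dom" "w \<in> dom"
  shows "scale_mat (w - z) (lax_quot z w \<Phi>) = lax z \<Phi> - lax w \<Phi>"
proof -
  have *: "(w - z) * (1 / ((z - u s * lam \<sigma>) * (w - u s * lam \<sigma>)))
      = 1 / (z - u s * lam \<sigma>) - 1 / (w - u s * lam \<sigma>)" if "s \<in> S" for s \<sigma>
    using assms that by (simp add: dom_def diff_frac_eq)
  have "scale_mat (w - z) (lax_quot z w \<Phi>) = scale_mat \<kappa> (\<Sum>s\<in>S. \<Sum>\<sigma>\<in>UNIV.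
    scale_mat ((w - z) * (1 / ((z - u s * lam \<sigma>) * (w - u s * lam \<sigma>)))) (Q \<Phi> s \<sigma>))"
    unfolding lax_quot_def scale_mat_scale_mat mult.commute[of "w - z" \<kappa>]
    by (simp add: scale_mat_sum mult.assoc)
  also have "\<dots> = scale_mat \<kappa> (\<Sum>s\<in>S. \<Sum>\<sigma>\<in>UNIV.
      scale_mat (1 / (z - u s * lam \<sigma>)) (Q \<Phi> s \<sigma>) - scale_mat (1 / (w - u s * lam \<sigma>)) (Q \<Phi> s \<sigma>))"
    using * by (intro arg_cong[where f = "scale_mat \<kappa>"] sum.cong refl) (simp add: vec_eq_iff left_diff_distrib)
  also have "\<dots> = lax z \<Phi> - lax w \<Phi>"
    by (simp add: lax_alt sum_subtractf scale_mat_diff)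
  finally show ?thesis .
qed

lemma open_dom: "open dom"
proof -
  have "dom = - (\<Union>s\<in>S. \<Union>\<sigma>. {u s * lam \<sigma>})" by (auto simp: dom_def)
  moreover have "closed (\<Union>s\<in>S. \<Union>\<sigma>. {u s * lam \<sigma>})"
    using finite_S by (intro closed_UN) auto
  ultimately show ?thesis by (simp only: open_Compl)
qed

lemma tendsto_lax_quot:
  assumes "z \<in> dom"
  shows "((\<lambda>w. lax_quot z w \<Phi>) \<longlongrightarrow> lax_quot z z \<Phi>) (at z)"
proof -
  have "((\<lambda>w. scale_mat (1 / ((z - u s * lam \<sigma>) * (w - u s * lam \<sigma>))) X)
      \<longlongrightarrow> scale_mat (1 / ((z - u s * lam \<sigma>) * (z - u s * lam \<sigma>))) X) (at z)"
    if "s \<in> S" for s \<sigma> and X :: "complex^'m^'m"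
    using assms that by (intro vec_tendstoI) (auto simp: dom_def intro!: tendsto_eq_intros)
  then show ?thesis
    unfolding lax_quot_def
    by (intro bounded_linear.tendsto[OF bounded_linear_scale_mat] tendsto_sum)
qed

text \<open>For \<open>w\<close> different from \<open>z\<close> the quotient is a multiple of a
  difference of two Lax matrices. At \<open>w = z\<close> the commutation passes to the limit, since
  all points near \<open>z\<close> lie in the open set \<open>dom\<close>.\<close>

lemma commute_lax_quot:
  assumes T: "\<And>v. v \<in> dom \<Longrightarrow> T ** lax v \<Phi> = lax v \<Phi> ** T" and "z \<in> dom" "w \<in> dom"
  shows "T ** lax_quot z w \<Phi> = lax_quot z w \<Phi> ** T"
proof -
  have neq: "T ** lax_quot z v \<Phi> = lax_quot z v \<Phi> ** T" if "v \<in> dom" "v \<noteq> z" for v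
  proof -
    have "lax_quot z v \<Phi> = scale_mat (1 / (v - z)) (scale_mat (v - z) (lax_quot z v \<Phi>))"
      using that by simp
    then have "lax_quot z v \<Phi> = scale_mat (1 / (v - z)) (lax z \<Phi> - lax v \<Phi>)"
      unfolding lax_quot_eq[OF \<open>z \<in> dom\<close> \<open>v \<in> dom\<close>] .
    then show ?thesis
      using T that \<open>z \<in> dom\<close> by (simp add: matrix_diff_ldistrib matrix_diff_rdistrib)
  qed
  show ?thesis
  proof (cases "w = z")
    case True
    let ?C = "\<lambda>X. T ** X - X ** T"
    have "((\<lambda>v. ?C (lax_quot z v \<Phi>)) \<longlongrightarrow> ?C (lax_quot z z \<Phi>)) (at z)"
      by (intro tendsto_diff bounded_bilinear.tendsto[OF bounded_bilinear_matrix_mult] tendsto_const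
          tendsto_lax_quot[OF \<open>z \<in> dom\<close>])
    moreover have "\<forall>\<^sub>F v in at z. ?C (lax_quot z v \<Phi>) = 0"
      using eventually_at_in_open[OF open_dom \<open>z \<in> dom\<close>]
      by eventually_elim (use neq in auto)
    then have "((\<lambda>v. ?C (lax_quot z v \<Phi>)) \<longlongrightarrow> 0) (at z)"
      by (rule tendsto_eventually)
    ultimately have "?C (lax_quot z z \<Phi>) = 0"
      by (rule tendsto_unique[OF trivial_limit_at])
    with True show ?thesis by simp
  qed (use neq \<open>w \<in> dom\<close> in simp)
qed

text \<open>For \<open>w\<close> different from \<open>z\<close>, \<open>A\<close> commutes with
  L(z) and \<open>B\<close> with L(w), and the quotient is a multiple of their difference. For
  \<open>w = z\<close> that yields only 0 = 0; instead the powers merge, A B - B A = [T1, T2]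
  L^(k+l), and \<open>T1\<close> commutes with L^(k+l) times the quotient.\<close>

lemma trace_commutator_lax_quot:
  fixes k l :: nat
  assumes T1: "\<And>v. v \<in> dom \<Longrightarrow> T1 ** lax v \<Phi> = lax v \<Phi> ** T1"
    and T2: "\<And>v. v \<in> dom \<Longrightarrow> T2 ** lax v \<Phi> = lax v \<Phi> ** T2"
    and z: "z \<in> dom" and w: "w \<in> dom"
  defines "A \<equiv> T1 ** mat_pow (lax z \<Phi>) k" and "B \<equiv> T2 ** mat_pow (lax w \<Phi>) l"
  shows "trace ((A ** B - B ** A) ** lax_quot z w \<Phi>) = 0"
proof (cases "w = z")
  case False
  have "A ** lax z \<Phi> = lax z \<Phi> ** A"
    unfolding A_def by (metis T1[OF z] mat_pow_commute matrix_mul_assoc)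
  moreover have "B ** lax w \<Phi> = lax w \<Phi> ** B"
    unfolding B_def by (metis T2[OF w] mat_pow_commute matrix_mul_assoc)
  ultimately have "trace ((A ** B - B ** A) ** scale_mat (w - z) (lax_quot z w \<Phi>)) = 0"
    unfolding lax_quot_eq[OF z w] by (rule trace_commutator_eq_0)
  then show ?thesis using False by simp
next
  case True
  let ?L = "lax z \<Phi>" and ?M = "lax_quot z z \<Phi>"
  define X where "X = mat_pow ?L (k + l) ** ?M"
  have prod: "T ** mat_pow ?L i ** (T' ** mat_pow ?L j) = T ** T' ** mat_pow ?L (i + j)"
    if "T' ** ?L = ?L ** T'" for T T' i j
  proof -
    have "T ** mat_pow ?L i ** (T' ** mat_pow ?L j) = T ** (mat_pow ?L i ** T') ** mat_pow ?L j"
      by (simp add: matrix_mul_assoc)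
    also have "\<dots> = T ** (T' ** mat_pow ?L i) ** mat_pow ?L j"
      by (simp only: mat_pow_commute[OF that])
    finally show ?thesis by (simp add: matrix_mul_assoc mat_pow_add)
  qed
  have AB: "A ** B = T1 ** T2 ** mat_pow ?L (k + l)"
    unfolding A_def B_def True by (rule prod[OF T2[OF z]])
  have BA: "B ** A = T2 ** T1 ** mat_pow ?L (k + l)"
    unfolding A_def B_def True add.commute[of k] by (rule prod[OF T1[OF z]])
  have "T1 ** X = mat_pow ?L (k + l) ** (T1 ** ?M)"
    unfolding X_def by (simp add: matrix_mul_assoc mat_pow_commute[OF T1[OF z]])
  also have "\<dots> = X ** T1"
    unfolding X_def by (simp add: matrix_mul_assoc[symmetric] commute_lax_quot[OF T1 z z])
  finally have "T1 ** X = X ** T1" .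
  then have "trace (T1 ** T2 ** X) = trace (T2 ** T1 ** X)"
    by (rule trace_mult_swap)
  then show ?thesis
    unfolding AB BA True by (simp add: X_def matrix_diff_rdistrib trace_sub matrix_mul_assoc)
qed

text \<open>The dual of the dependence of \<open>lax z\<close> on column \<sigma>: pairing
  \<open>A\<close> by the trace with a variation of \<open>lax z\<close> in that column is the same
  as pairing \<open>grad_op z A \<sigma>\<close> with the variation of
  \<open>P \<Phi> \<sigma>\<close>.\<close>

definition grad_op :: "complex \<Rightarrow> complex^'m^'m \<Rightarrow> 'r \<Rightarrow> complex^'m^'m" where
  "grad_op z A \<sigma> = scale_mat \<kappa> (\<Sum>s\<in>S. scale_mat (1 / (z - u s * lam \<sigma>)) (adj (U s) ** A ** U s))"

text \<open>Translating the summation index by \<open>t\<close> pulls out conjugation by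
  \<open>U t\<close>, the one occurring in term \<open>t\<close> of the other gradient. Each
  remaining weight is that of pole \<open>t\<close> at the rotated point \<open>w / u s\<close>,
  times \<open>1 / u s\<close>.\<close>

lemma grad_op_shift:
  assumes t: "t \<in> S"
  shows "grad_op w B \<sigma> = adj (U t) ** scale_mat \<kappa> (\<Sum>s\<in>S.
    scale_mat (1 / u s * (1 / (w / u s - u t * lam \<sigma>))) (adj (U s) ** B ** U s)) ** U t"
proof -
  obtain \<pi> where bij: "bij_betw \<pi> S S" and \<pi>: "\<And>s. s \<in> S \<Longrightarrow> u (\<pi> s) = u t * u s"
    and U\<pi>: "\<And>s. s \<in> S \<Longrightarrow> U (\<pi> s) = U s ** U t \<or> U (\<pi> s) = - (U s ** U t)"
    using shift[OF t] by blast
  have "(\<Sum>s\<in>S. scale_mat (1 / (w - u s * lam \<sigma>)) (adj (U s) ** B ** U s))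
      = (\<Sum>s\<in>S. scale_mat (1 / (w - u (\<pi> s) * lam \<sigma>)) (adj (U (\<pi> s)) ** B ** U (\<pi> s)))"
    by (rule sum.reindex_bij_betw[OF bij, symmetric])
  also have "\<dots> = (\<Sum>s\<in>S. scale_mat (1 / u s * (1 / (w / u s - u t * lam \<sigma>)))
      (adj (U t) ** (adj (U s) ** B ** U s) ** U t))"
  proof (intro sum.cong refl)
    fix s assume s: "s \<in> S"
    have "u s * (w / u s - u t * lam \<sigma>) = w - u (\<pi> s) * lam \<sigma>"
      using u_nonzero[OF s] by (simp add: \<pi>[OF s] algebra_simps)
    then have "1 / (w - u (\<pi> s) * lam \<sigma>) = 1 / u s * (1 / (w / u s - u t * lam \<sigma>))"
      by (metis mult_1 times_divide_times_eq)
    moreover have "adj (U (\<pi> s)) ** B ** U (\<pi> s) = adj (U t) ** (adj (U s) ** B ** U s) ** U t"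
      using U\<pi>[OF s] by (auto simp: adj_mult matrix_mul_assoc)
    ultimately show "scale_mat (1 / (w - u (\<pi> s) * lam \<sigma>)) (adj (U (\<pi> s)) ** B ** U (\<pi> s))
      = scale_mat (1 / u s * (1 / (w / u s - u t * lam \<sigma>))) (adj (U t) ** (adj (U s) ** B ** U s) ** U t)"
      by simp
  qed
  finally show ?thesis
    by (simp add: grad_op_def matrix_sum_left matrix_sum_right)
qed

text \<open>By \<open>lax_shift\<close>, \<open>lax v\<close> is a multiple of the conjugate of the
  Lax matrix at \<open>u s * v\<close>, with which \<open>T\<close> commutes; conjugation preserves
  commutation.\<close>

lemma commute_lax_conjugate:
  assumes T: "\<And>v. v \<in> dom \<Longrightarrow> T ** lax v \<Phi> = lax v \<Phi> ** T" and s: "s \<in> S" and v: "v \<in> dom"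
  shows "(adj (U s) ** T ** U s) ** lax v \<Phi> = lax v \<Phi> ** (adj (U s) ** T ** U s)"
proof -
  let ?L = "scale_mat (u s) (lax (u s * v) \<Phi>)"
  have L: "lax v \<Phi> = adj (U s) ** ?L ** U s"
    unfolding lax_shift[OF s, symmetric] using s by (simp add: matrix_mul_assoc)
  have "T ** ?L = ?L ** T" using T[OF dom_shift(1)[OF s v]] by simp
  then have "commutator (adj (U s) ** T ** U s) (lax v \<Phi>) = 0"
    unfolding L by (subst commutator_conjugate) (simp_all add: s commutator_def)
  then show ?thesis by (simp add: commutator_def)
qed

lemma conjugate_mult_lax_pow:
  assumes s: "s \<in> S"
  shows "adj (U s) ** (T ** mat_pow (lax w \<Phi>) l) ** U s
    = scale_mat ((1 / u s) ^ l) ((adj (U s) ** T ** U s) ** mat_pow (lax (w / u s) \<Phi>) l)"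
proof -
  have "adj (U s) ** (T ** X) ** U s = (adj (U s) ** T ** U s) ** (adj (U s) ** X ** U s)" for X
    using s by (simp add: matrix_mul_assoc)
  moreover have "adj (U s) ** mat_pow (lax w \<Phi>) l ** U s = scale_mat ((1 / u s) ^ l) (mat_pow (lax (w / u s) \<Phi>) l)"
    using s by (simp flip: mat_pow_conjugate mat_pow_scale_mat add: lax_shift')
  ultimately show ?thesis by simp
qed

text \<open>The double sum over twists is organised by the relative twist \<open>s\<close>. For
  fixed \<open>s\<close> the other sums assemble a divided difference, and each resulting trace
  vanishes separately.\<close>

lemma sum_trace_commutator_grad_op:
  fixes k l :: nat
  assumes T1: "\<And>v. v \<in> dom \<Longrightarrow> T1 ** lax v \<Phi> = lax v \<Phi> ** T1"
    and T2: "\<And>v. v \<in> dom \<Longrightarrow> T2 ** lax v \<Phi> = lax v \<Phi> ** T2"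
    and z: "z \<in> dom" and w: "w \<in> dom"
  defines "A \<equiv> T1 ** mat_pow (lax z \<Phi>) k" and "B \<equiv> T2 ** mat_pow (lax w \<Phi>) l"
  shows "(\<Sum>\<sigma>\<in>UNIV. trace (commutator (grad_op z A \<sigma>) (grad_op w B \<sigma>) ** P \<Phi> \<sigma>)) = 0"
proof -
  define B' where "B' s = adj (U s) ** B ** U s" for s
  \<comment> \<open>After \<open>grad_op_shift\<close> both arguments are conjugated by the same
    \<open>U t\<close>; cyclicity moves this conjugation onto \<open>P\<close>, turning it into
    \<open>Q\<close>.\<close>
  have one: "trace (commutator (adj (U t) ** A ** U t) (grad_op w B \<sigma>) ** P \<Phi> \<sigma>)
      = \<kappa> * (\<Sum>s\<in>S. 1 / u s * (1 / (w / u s - u t * lam \<sigma>)) * trace (commutator A (B' s) ** Q \<Phi> t \<sigma>))"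
    if t: "t \<in> S" for t \<sigma>
  proof -
    have "trace (adj (U t) ** X ** U t ** P \<Phi> \<sigma>) = trace (X ** Q \<Phi> t \<sigma>)" for X
    proof -
      have "trace (adj (U t) ** (X ** U t ** P \<Phi> \<sigma>)) = trace (X ** U t ** P \<Phi> \<sigma> ** adj (U t))"
        by (rule trace_mul_sym)
      then show ?thesis by (simp add: Q_def matrix_mul_assoc)
    qed
    then show ?thesis
      unfolding grad_op_shift[OF t] B'_def[symmetric]
      by (subst commutator_conjugate)
         (simp_all add: t commutator_sum matrix_sum_left trace_sum)
  qed
  have "(\<Sum>\<sigma>\<in>UNIV. trace (commutator (grad_op z A \<sigma>) (grad_op w B \<sigma>) ** P \<Phi> \<sigma>))
     = (\<Sum>\<sigma>\<in>UNIV. \<Sum>t\<in>S. \<Sum>s\<in>S. \<kappa> / u s * (\<kappa> * (1 / ((z - u t * lam \<sigma>) * (w / u s - u t * lam \<sigma>))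
        * trace (commutator A (B' s) ** Q \<Phi> t \<sigma>))))"
  proof (intro sum.cong refl)
    fix \<sigma>
    have "trace (commutator (grad_op z A \<sigma>) (grad_op w B \<sigma>) ** P \<Phi> \<sigma>)
      = \<kappa> * (\<Sum>t\<in>S. 1 / (z - u t * lam \<sigma>) *
          trace (commutator (adj (U t) ** A ** U t) (grad_op w B \<sigma>) ** P \<Phi> \<sigma>))"
      unfolding grad_op_def[of z] by (simp add: commutator_sum matrix_sum_left trace_sum)
    also have "\<dots> = \<kappa> * (\<Sum>t\<in>S. 1 / (z - u t * lam \<sigma>) * (\<kappa> * (\<Sum>s\<in>S. 1 / u s *
        (1 / (w / u s - u t * lam \<sigma>)) * trace (commutator A (B' s) ** Q \<Phi> t \<sigma>))))"
      using one by simp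
    also have "\<dots> = (\<Sum>t\<in>S. \<Sum>s\<in>S. \<kappa> / u s * (\<kappa> * (1 / ((z - u t * lam \<sigma>) * (w / u s - u t * lam \<sigma>))
        * trace (commutator A (B' s) ** Q \<Phi> t \<sigma>))))"
      by (simp add: sum_distrib_left mult_ac divide_inverse)
    finally show "trace (commutator (grad_op z A \<sigma>) (grad_op w B \<sigma>) ** P \<Phi> \<sigma>) = \<dots>" .
  qed
  also have "\<dots> = (\<Sum>t\<in>S. \<Sum>\<sigma>\<in>UNIV. \<Sum>s\<in>S. \<kappa> / u s * (\<kappa> * (1 / ((z - u t * lam \<sigma>) * (w / u s - u t * lam \<sigma>))
        * trace (commutator A (B' s) ** Q \<Phi> t \<sigma>))))"
    by (rule sum.swap)
  also have "\<dots> = (\<Sum>t\<in>S. \<Sum>s\<in>S. \<Sum>\<sigma>\<in>UNIV. \<kappa> / u s * (\<kappa> * (1 / ((z - u t * lam \<sigma>) * (w / u s - u t * lam \<sigma>))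
        * trace (commutator A (B' s) ** Q \<Phi> t \<sigma>))))"
    by (intro sum.cong refl sum.swap)
  also have "\<dots> = (\<Sum>s\<in>S. \<Sum>t\<in>S. \<Sum>\<sigma>\<in>UNIV. \<kappa> / u s * (\<kappa> * (1 / ((z - u t * lam \<sigma>) * (w / u s - u t * lam \<sigma>))
        * trace (commutator A (B' s) ** Q \<Phi> t \<sigma>))))"
    by (rule sum.swap)
  \<comment> \<open>For fixed \<open>s\<close>, the product of the two weights is the coefficient of
    \<open>Q \<Phi> t \<sigma>\<close> in the divided difference at \<open>z\<close> and
    \<open>w / u s\<close>; one \<kappa> is absorbed into it.\<close>
  also have "\<dots> = (\<Sum>s\<in>S. \<kappa> / u s * trace (commutator A (B' s) ** lax_quot z (w / u s) \<Phi>))"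
    by (simp add: lax_quot_def matrix_sum_right trace_sum sum_distrib_left)
  also have "\<dots> = 0"
  proof (rule sum.neutral, rule ballI)
    fix s assume s: "s \<in> S"
    have B': "B' s = scale_mat ((1 / u s) ^ l) ((adj (U s) ** T2 ** U s) ** mat_pow (lax (w / u s) \<Phi>) l)"
      unfolding B'_def B_def using s by (rule conjugate_mult_lax_pow)
    have "trace (commutator A (adj (U s) ** T2 ** U s ** mat_pow (lax (w / u s) \<Phi>) l)
        ** lax_quot z (w / u s) \<Phi>) = 0"
      unfolding A_def commutator_def
      by (rule trace_commutator_lax_quot[OF T1 commute_lax_conjugate[OF T2 s] z dom_shift(2)[OF s w]])
    then show "\<kappa> / u s * trace (commutator A (B' s) ** lax_quot z (w / u s) \<Phi>) = 0"
      by (simp add: B')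
  qed
  finally show ?thesis .
qed

section \<open>Partial derivatives and the Poisson bracket\<close>

lemma lax_has_vector_derivative:
  "((\<lambda>t. lax z (\<Phi> + t *\<^sub>R axis \<sigma> (axis j 1))) has_vector_derivative
    scale_mat \<kappa> (\<Sum>s\<in>S. scale_mat (1 / (z - u s * lam \<sigma>))
      (U s ** outer_deriv j (\<Phi> $ \<sigma>) ** transpose (U s) ** W))) (at 0)"
proof -
  have bl: "bounded_linear (\<lambda>X :: complex^'m^'m. scale_mat c (A ** X ** B ** C))" for c A B C
    by (intro bounded_linear_compose[OF bounded_linear_scale_mat]
        bounded_linear_compose[OF bounded_bilinear.bounded_linear_left[OF bounded_bilinear_matrix_mult]]
        bounded_bilinear.bounded_linear_right[OF bounded_bilinear_matrix_mult])
  \<comment> \<open>Moving one coordinate of column \<sigma> leaves every other column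
    fixed.\<close>
  have "((\<lambda>t. outer ((\<Phi> + t *\<^sub>R axis \<sigma> (axis j 1)) $ \<tau>)) has_vector_derivative
      (if \<tau> = \<sigma> then outer_deriv j (\<Phi> $ \<tau>) else 0)) (at 0)" for \<tau>
  proof (cases "\<tau> = \<sigma>")
    case True
    then show ?thesis using outer_has_vector_derivative[of "\<Phi> $ \<tau>" j] by simp
  next
    case False
    then show ?thesis by (simp add: axis_def)
  qed
  note d = bounded_linear.has_vector_derivative[OF bl this]
  have "((\<lambda>t. lax z (\<Phi> + t *\<^sub>R axis \<sigma> (axis j 1))) has_vector_derivative
    0 + scale_mat \<kappa> (\<Sum>s\<in>S. \<Sum>\<tau>\<in>UNIV. scale_mat (1 / (z - u s * lam \<tau>))
      (U s ** (if \<tau> = \<sigma> then outer_deriv j (\<Phi> $ \<tau>) else 0) ** transpose (U s) ** W))) (at 0)"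
    unfolding lax_def
    by (intro has_vector_derivative_add has_vector_derivative_const
        bounded_linear.has_vector_derivative[OF bounded_linear_scale_mat] has_vector_derivative_sum d)
  moreover have "(\<Sum>\<tau>\<in>UNIV. scale_mat (1 / (z - u s * lam \<tau>))
      (U s ** (if \<tau> = \<sigma> then outer_deriv j (\<Phi> $ \<tau>) else 0) ** transpose (U s) ** W))
    = scale_mat (1 / (z - u s * lam \<sigma>)) (U s ** outer_deriv j (\<Phi> $ \<sigma>) ** transpose (U s) ** W)" for s
    by (subst sum.remove[of _ \<sigma>]) (auto intro!: sum.neutral)
  ultimately show ?thesis by simp
qed

text \<open>Commutation with \<theta> reduces the derivative to one trace of \<open>A\<close>
  against the variation of the Lax matrix. Cyclicity isolates the variation of \<open>outer\<close>,
  which symmetrises its partner.\<close>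

lemma pderiv_trace_lax_pow:
  fixes k :: nat
  assumes "\<theta> ** lax z \<Phi> = lax z \<Phi> ** \<theta>"
  defines "A \<equiv> scale_mat (of_nat k) (\<theta> ** mat_pow (lax z \<Phi>) (k - 1))"
  shows "pderiv_coord j \<sigma> (\<lambda>\<Psi>. trace (\<theta> ** mat_pow (lax z \<Psi>) k)) \<Phi>
    = ((W ** grad_op z (A - adj A) \<sigma>) *v (\<chi> i. complex_of_real (\<Phi> $ \<sigma> $ i))) $ j"
proof -
  let ?D = "scale_mat \<kappa> (\<Sum>s\<in>S. scale_mat (1 / (z - u s * lam \<sigma>))
      (U s ** outer_deriv j (\<Phi> $ \<sigma>) ** transpose (U s) ** W))"
  let ?X = "\<lambda>s. transpose (U s) ** W ** A ** U s"
  have "((\<lambda>t. trace (\<theta> ** mat_pow (lax z (\<Phi> + t *\<^sub>R axis \<sigma> (axis j 1))) k)) has_vector_derivative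
      of_nat k * trace (\<theta> ** mat_pow (lax z \<Phi>) (k - 1) ** ?D)) (at 0)"
    using trace_mat_pow_has_vector_derivative[OF lax_has_vector_derivative] assms(1) by simp
  then have "pderiv_coord j \<sigma> (\<lambda>\<Psi>. trace (\<theta> ** mat_pow (lax z \<Psi>) k)) \<Phi> = trace (A ** ?D)"
    unfolding pderiv_coord_def A_def by (simp add: vector_derivative_at)
  also have "\<dots> = \<kappa> * (\<Sum>s\<in>S. 1 / (z - u s * lam \<sigma>) * trace (?X s ** outer_deriv j (\<Phi> $ \<sigma>)))"
  proof -
    have "trace (A ** (U s ** Y ** transpose (U s) ** W)) = trace (?X s ** Y)" for s Y
    proof -
      have "trace ((A ** U s ** Y) ** (transpose (U s) ** W)) = trace ((transpose (U s) ** W) ** (A ** U s ** Y))"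
        by (rule trace_mul_sym)
      then show ?thesis by (simp add: matrix_mul_assoc)
    qed
    then show ?thesis by (simp add: matrix_sum_right trace_sum)
  qed
  also have "\<dots> = \<kappa> * (\<Sum>s\<in>S. 1 / (z - u s * lam \<sigma>) *
      ((W ** (adj (U s) ** (A - adj A) ** U s)) *v (\<chi> i. complex_of_real (\<Phi> $ \<sigma> $ i))) $ j)"
  proof -
    \<comment> \<open>Since \<open>W\<close> is antisymmetric, adding the transpose amounts to
      subtracting the adjoint of \<open>A\<close>.\<close>
    have "?X s + transpose (?X s) = W ** (adj (U s) ** (A - adj A) ** U s)" for s
    proof -
      have "transpose (?X s) = - (transpose (U s) ** W ** adj A ** U s)"
        by (simp add: matrix_transpose_mul W_antisym W_adj matrix_mul_assoc[symmetric])
      then show ?thesis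
        by (simp add: matrix_mul_assoc W_adj matrix_diff_ldistrib matrix_diff_rdistrib)
    qed
    then show ?thesis by (simp only: trace_mult_outer_deriv)
  qed
  also have "\<dots> = ((W ** grad_op z (A - adj A) \<sigma>) *v (\<chi> i. complex_of_real (\<Phi> $ \<sigma> $ i))) $ j"
  proof -
    have "(scale_mat c Y *v x) $ j = c * (Y *v x) $ j" for c and Y :: "complex^'m^'m" and x
      by (simp add: matrix_vector_mult_def sum_distrib_left mult.assoc)
    moreover have "((\<Sum>s\<in>S. f s) *v x) $ j = (\<Sum>s\<in>S. (f s *v x) $ j)" for f :: "'i \<Rightarrow> complex^'m^'m" and x
      by (simp add: matrix_vector_mult_def sum_distrib_right sum.swap[of _ S])
    ultimately show ?thesis by (simp add: grad_op_def matrix_sum_right)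
  qed
  finally show ?thesis .
qed

lemma adj_grad_op: "adj A = - A \<Longrightarrow> adj (grad_op z A \<sigma>) = - grad_op z A \<sigma>"
  by (simp add: grad_op_def adj_sum adj_mult matrix_mul_assoc sum_negf)

text \<open>The factor 2 reflects that the trace of a product of the two gradients with
  \<open>P\<close> is antisymmetric under exchanging them, hence half the trace of their commutator
  with \<open>P\<close>.\<close>

lemma sum_bilinear_grad_op:
  fixes \<Phi> :: "real^'m^'r" and \<sigma> :: 'r
  assumes A: "adj A = - A" and B: "adj B = - B"
  defines "x \<equiv> \<chi> i. complex_of_real (\<Phi> $ \<sigma> $ i)"
  shows "2 * (\<Sum>j\<in>UNIV. \<Sum>k\<in>UNIV. Wi $ j $ k * ((W ** grad_op z A \<sigma>) *v x) $ j * ((W ** grad_op w B \<sigma>) *v x) $ k)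
    = trace (commutator (grad_op z A \<sigma>) (grad_op w B \<sigma>) ** P \<Phi> \<sigma>)"
proof -
  let ?R = "grad_op z A \<sigma>" and ?R' = "grad_op w B \<sigma>"
  have R: "adj ?R = - ?R" "adj ?R' = - ?R'" using A B by (simp_all add: adj_grad_op)
  \<comment> \<open>\<open>W ** ?R\<close> is symmetric, being a Hamiltonian matrix multiplied by
    the form, so the transpose in \<open>bilinear_form_outer\<close> disappears.\<close>
  have "transpose ?R ** W = - (W ** ?R)"
    using W_adj[of ?R] by (simp add: R)
  then have "transpose (W ** ?R) = W ** ?R"
    by (simp add: matrix_transpose_mul W_antisym)
  then have "(\<Sum>j\<in>UNIV. \<Sum>k\<in>UNIV. Wi $ j $ k * ((W ** ?R) *v x) $ j * ((W ** ?R') *v x) $ k)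
      = trace (W ** ?R ** Wi ** (W ** ?R') ** outer (\<Phi> $ \<sigma>))"
    unfolding x_def bilinear_form_outer by simp
  also have "\<dots> = trace (W ** (?R ** ?R' ** outer (\<Phi> $ \<sigma>)))"
    by (simp add: matrix_mul_assoc)
  also have "\<dots> = trace ((?R ** ?R' ** outer (\<Phi> $ \<sigma>)) ** W)"
    by (rule trace_mul_sym)
  finally have *: "(\<Sum>j\<in>UNIV. \<Sum>k\<in>UNIV. Wi $ j $ k * ((W ** ?R) *v x) $ j * ((W ** ?R') *v x) $ k)
      = trace (?R ** ?R' ** P \<Phi> \<sigma>)"
    by (simp add: P_def matrix_mul_assoc)
  \<comment> \<open>The adjoint preserves the trace, reverses the product and negates each of the
    three factors, leaving one overall sign.\<close>
  have "trace (?R ** ?R' ** P \<Phi> \<sigma>) = trace (adj (?R ** ?R' ** P \<Phi> \<sigma>))"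
    by (rule trace_adj[symmetric])
  also have "\<dots> = - trace (P \<Phi> \<sigma> ** (?R' ** ?R))"
    by (simp add: adj_mult R adj_P)
  also have "\<dots> = - trace (?R' ** ?R ** P \<Phi> \<sigma>)"
    by (simp add: trace_mul_sym[of "P \<Phi> \<sigma>"])
  finally show ?thesis
    unfolding * by (simp add: commutator_def matrix_diff_rdistrib trace_sub)
qed

lemma poisson_trace_lax_pow:
  assumes \<theta>1: "\<And>v \<Psi>. v \<in> dom \<Longrightarrow> \<theta>1 ** lax v \<Psi> = lax v \<Psi> ** \<theta>1"
    and \<theta>2: "\<And>v \<Psi>. v \<in> dom \<Longrightarrow> \<theta>2 ** lax v \<Psi> = lax v \<Psi> ** \<theta>2"
    and z: "z \<in> dom" and w: "w \<in> dom"
  shows "(\<Sum>i\<in>UNIV. \<Sum>j\<in>UNIV. \<Sum>\<sigma>\<in>UNIV. Wi $ i $ j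
    * pderiv_coord i \<sigma> (\<lambda>\<Psi>. trace (\<theta>1 ** mat_pow (lax z \<Psi>) k)) \<Phi>
    * pderiv_coord j \<sigma> (\<lambda>\<Psi>. trace (\<theta>2 ** mat_pow (lax w \<Psi>) l)) \<Phi>) = 0"
proof -
  define antisym where "antisym \<theta> v k =
    (let A = scale_mat (of_nat k) (\<theta> ** mat_pow (lax v \<Phi>) (k - 1)) in A - adj A)" for \<theta> v and k :: nat
  \<comment> \<open>Applying \<open>adj\<close> to \<theta> L^(k-1) gives (-1)^(k-1) L^(k-1)
    \<open>adj \<theta>\<close>, and \<open>adj \<theta>\<close> again commutes with L. Hence the
    antisymmetrised gradient keeps the form of a commuting constant times L^(k-1).\<close>
  define T where "T \<theta> k = scale_mat (of_nat k) (\<theta> - scale_mat ((- 1) ^ (k - 1)) (adj \<theta>))" for \<theta> and k :: nat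
  have adj_antisym: "adj (antisym \<theta> v k) = - antisym \<theta> v k" for \<theta> v k
    by (simp add: antisym_def Let_def adj_diff)
  have commute_adj: "adj \<theta> ** lax v \<Phi> = lax v \<Phi> ** adj \<theta>"
    if "\<theta> ** lax v \<Phi> = lax v \<Phi> ** \<theta>" for \<theta> v
    using arg_cong[OF that, of adj] by (simp add: adj_mult adj_lax)
  have commute_T: "T \<theta> k ** lax v \<Phi> = lax v \<Phi> ** T \<theta> k"
    if "\<theta> ** lax v \<Phi> = lax v \<Phi> ** \<theta>" for \<theta> v k
    using that commute_adj[OF that] by (simp add: T_def matrix_diff_ldistrib matrix_diff_rdistrib)
  have antisym_eq: "antisym \<theta> v k = T \<theta> k ** mat_pow (lax v \<Phi>) (k - 1)"
    if "\<theta> ** lax v \<Phi> = lax v \<Phi> ** \<theta>" for \<theta> v k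
  proof -
    have "mat_pow (- lax v \<Phi>) i = scale_mat ((- 1) ^ i) (mat_pow (lax v \<Phi>) i)" for i
    proof -
      have "scale_mat (- 1) (lax v \<Phi>) = - lax v \<Phi>" by (simp add: vec_eq_iff)
      then show ?thesis using mat_pow_scale_mat[of "- 1" "lax v \<Phi>" i] by simp
    qed
    then have "adj (\<theta> ** mat_pow (lax v \<Phi>) (k - 1))
        = scale_mat ((- 1) ^ (k - 1)) (mat_pow (lax v \<Phi>) (k - 1) ** adj \<theta>)"
      by (simp only: adj_mult adj_mat_pow adj_lax scale_mat_mult_left)
    also have "mat_pow (lax v \<Phi>) (k - 1) ** adj \<theta> = adj \<theta> ** mat_pow (lax v \<Phi>) (k - 1)"
      by (rule mat_pow_commute[OF commute_adj[OF that], symmetric])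
    finally show ?thesis
      by (simp only: antisym_def T_def Let_def adj_scale_mat scale_mat_diff scale_mat_mult_left
          matrix_diff_rdistrib)
  qed
  let ?G = "\<lambda>\<theta> v k \<sigma>. W ** grad_op v (antisym \<theta> v k) \<sigma>" and ?x = "\<lambda>\<sigma>. \<chi> i. complex_of_real (\<Phi> $ \<sigma> $ i)"
  have "(\<Sum>i\<in>UNIV. \<Sum>j\<in>UNIV. \<Sum>\<sigma>\<in>UNIV. Wi $ i $ j
    * pderiv_coord i \<sigma> (\<lambda>\<Psi>. trace (\<theta>1 ** mat_pow (lax z \<Psi>) k)) \<Phi>
    * pderiv_coord j \<sigma> (\<lambda>\<Psi>. trace (\<theta>2 ** mat_pow (lax w \<Psi>) l)) \<Phi>)
    = (\<Sum>i\<in>UNIV. \<Sum>j\<in>UNIV. \<Sum>\<sigma>\<in>UNIV. Wi $ i $ j * (?G \<theta>1 z k \<sigma> *v ?x \<sigma>) $ i * (?G \<theta>2 w l \<sigma> *v ?x \<sigma>) $ j)"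
    by (simp add: pderiv_trace_lax_pow \<theta>1 \<theta>2 z w antisym_def Let_def)
  also have "\<dots> = (\<Sum>i\<in>UNIV. \<Sum>\<sigma>\<in>UNIV. \<Sum>j\<in>UNIV. Wi $ i $ j * (?G \<theta>1 z k \<sigma> *v ?x \<sigma>) $ i * (?G \<theta>2 w l \<sigma> *v ?x \<sigma>) $ j)"
    by (intro sum.cong refl sum.swap)
  also have "\<dots> = (\<Sum>\<sigma>\<in>UNIV. \<Sum>i\<in>UNIV. \<Sum>j\<in>UNIV. Wi $ i $ j * (?G \<theta>1 z k \<sigma> *v ?x \<sigma>) $ i * (?G \<theta>2 w l \<sigma> *v ?x \<sigma>) $ j)"
    by (rule sum.swap)
  finally have "2 * (\<Sum>i\<in>UNIV. \<Sum>j\<in>UNIV. \<Sum>\<sigma>\<in>UNIV. Wi $ i $ j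
    * pderiv_coord i \<sigma> (\<lambda>\<Psi>. trace (\<theta>1 ** mat_pow (lax z \<Psi>) k)) \<Phi>
    * pderiv_coord j \<sigma> (\<lambda>\<Psi>. trace (\<theta>2 ** mat_pow (lax w \<Psi>) l)) \<Phi>)
    = (\<Sum>\<sigma>\<in>UNIV. 2 * (\<Sum>i\<in>UNIV. \<Sum>j\<in>UNIV. Wi $ i $ j * (?G \<theta>1 z k \<sigma> *v ?x \<sigma>) $ i * (?G \<theta>2 w l \<sigma> *v ?x \<sigma>) $ j))"
    by (simp only: sum_distrib_left)
  also have "\<dots> = (\<Sum>\<sigma>\<in>UNIV. trace (commutator (grad_op z (antisym \<theta>1 z k) \<sigma>) (grad_op w (antisym \<theta>2 w l) \<sigma>) ** P \<Phi> \<sigma>))"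
    by (simp only: sum_bilinear_grad_op[OF adj_antisym adj_antisym])
  also have "\<dots> = 0"
    unfolding antisym_eq[OF \<theta>1[OF z]] antisym_eq[OF \<theta>2[OF w]]
    by (intro sum_trace_commutator_grad_op commute_T \<theta>1 \<theta>2 z w)
  finally show ?thesis by simp
qed

end

section \<open>Matrices up to sign\<close>

text \<open>Equality in the quotient by {I, -I}, expressed on representatives so that it combines
  directly with matrix products.\<close>

definition eq_upto_sign :: "'a::ring_1^'n^'m \<Rightarrow> 'a^'n^'m \<Rightarrow> bool" (infix "\<doteq>" 50) where
  "A \<doteq> B \<longleftrightarrow> A = B \<or> A = - B"

lemma eq_upto_sign_refl [simp]: "A \<doteq> A"
  by (simp add: eq_upto_sign_def)

lemma eq_upto_sign_sym: "A \<doteq> B \<Longrightarrow> B \<doteq> A"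
  by (auto simp: eq_upto_sign_def)

lemma eq_upto_sign_trans [trans]: "A \<doteq> B \<Longrightarrow> B \<doteq> C \<Longrightarrow> A \<doteq> C"
  by (auto simp: eq_upto_sign_def)

lemma eq_upto_sign_mult: "A \<doteq> A' \<Longrightarrow> B \<doteq> B' \<Longrightarrow> A ** B \<doteq> A' ** B'"
  by (auto simp: eq_upto_sign_def)

lemma eq_upto_sign_mat_pow: "A \<doteq> mat 1 \<Longrightarrow> mat_pow A k \<doteq> mat 1"
proof (induction k)
  case (Suc k)
  then show ?case using eq_upto_sign_mult[of A "mat 1" "mat_pow A k" "mat 1"] by simp
qed simp

lemma mat_pow_mult_exponent: "mat_pow A (k * l) = mat_pow (mat_pow A k) l"
  by (induction l) (simp_all add: mat_pow_add)

text \<open>Each of A, B and A B equals, up to sign, the inverse of its conjugate. Inverting conj(A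
  B) = conj(A) conj(B) reverses the factors, so A B is B A up to sign.\<close>

lemma commute_upto_sign:
  fixes A B :: "complex^'n^'n"
  assumes "conj_mat A ** A \<doteq> mat 1" and "conj_mat B ** B \<doteq> mat 1"
    and "conj_mat (A ** B) ** (A ** B) \<doteq> mat 1"
  shows "A ** B \<doteq> B ** A"
proof -
  have inv: "X ** conj_mat X \<doteq> mat 1" if "conj_mat X ** X \<doteq> mat 1" for X :: "complex^'n^'n"
    using that matrix_left_right_inverse[of X "conj_mat X"] matrix_left_right_inverse[of X "- conj_mat X"]
    by (auto simp: eq_upto_sign_def) (metis minus_minus)
  have "A ** B \<doteq> (B ** (A ** conj_mat A) ** conj_mat B) ** (A ** B)"
  proof -
    have "B ** (A ** conj_mat A) ** conj_mat B \<doteq> B ** mat 1 ** conj_mat B"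
      by (intro eq_upto_sign_mult eq_upto_sign_refl inv assms)
    also have "\<dots> \<doteq> mat 1" using inv[OF assms(2)] by simp
    finally have "(B ** (A ** conj_mat A) ** conj_mat B) ** (A ** B) \<doteq> mat 1 ** (A ** B)"
      by (intro eq_upto_sign_mult eq_upto_sign_refl)
    then show ?thesis by (simp add: eq_upto_sign_sym)
  qed
  also have "\<dots> = B ** A ** (conj_mat (A ** B) ** (A ** B))"
    by (simp add: conj_mat_mult matrix_mul_assoc)
  also have "\<dots> \<doteq> B ** A ** mat 1"
    by (intro eq_upto_sign_mult eq_upto_sign_refl assms)
  finally show ?thesis by simp
qed

section \<open>The symplectic group modulo sign and products with reduced exponents\<close>

lemma group_G_grp: "group (G_grp W)"
proof (rule groupI)
  fix A assume "A \<in> carrier (G_grp W)"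
  then have A: "invertible A" "transpose A ** cmat W ** A = cmat W" by (auto simp: G_grp_def)
  let ?B = "matrix_inv A"
  note AB = matrix_inv_mult[OF A(1)]
  have tr: "transpose ?B ** transpose A = mat 1"
    by (metis AB(1) matrix_transpose_mul transpose_mat)
  have "transpose ?B ** cmat W ** ?B = transpose ?B ** (transpose A ** cmat W ** A) ** ?B"
    by (simp add: A(2))
  also have "\<dots> = (transpose ?B ** transpose A) ** cmat W ** (A ** ?B)"
    by (simp add: matrix_mul_assoc)
  finally have "transpose ?B ** cmat W ** ?B = cmat W" by (simp add: tr AB)
  moreover have "invertible ?B" using AB by (auto simp: invertible_def)
  ultimately show "\<exists>B\<in>carrier (G_grp W). B \<otimes>\<^bsub>G_grp W\<^esub> A = \<one>\<^bsub>G_grp W\<^esub>"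
    using AB by (intro bexI[of _ ?B]) (auto simp: G_grp_def)
next
  fix A B assume "A \<in> carrier (G_grp W)" "B \<in> carrier (G_grp W)"
  then have A: "invertible A" "transpose A ** cmat W ** A = cmat W"
    and B: "invertible B" "transpose B ** cmat W ** B = cmat W" by (auto simp: G_grp_def)
  have "transpose (A ** B) ** cmat W ** (A ** B) = transpose B ** (transpose A ** cmat W ** A) ** B"
    by (simp add: matrix_transpose_mul matrix_mul_assoc)
  then show "A \<otimes>\<^bsub>G_grp W\<^esub> B \<in> carrier (G_grp W)"
    using A B by (simp add: G_grp_def invertible_mult)
next
  show "\<one>\<^bsub>G_grp W\<^esub> \<in> carrier (G_grp W)" by (auto simp: G_grp_def invertible_def)
qed (auto simp: G_grp_def matrix_mul_assoc)

lemma mat_1_in_G_grp: "mat 1 \<in> carrier (G_grp W)" "- mat 1 \<in> carrier (G_grp W)"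
  by (auto simp: G_grp_def invertible_def intro: exI[of _ "mat 1"] exI[of _ "- mat 1"])

text \<open>The scalars 1 and -1 are central; normality makes the quotient a group, in which orders
  can be used.\<close>

lemma normal_pm1: "{mat 1, - mat 1} \<lhd> G_grp W"
proof -
  interpret group "G_grp W" by (rule group_G_grp)
  have mult: "A \<otimes>\<^bsub>G_grp W\<^esub> B = A ** B" and one: "\<one>\<^bsub>G_grp W\<^esub> = mat 1" for A B
    by (simp_all add: G_grp_def)
  have "inv\<^bsub>G_grp W\<^esub> (- mat 1) = - mat 1"
    by (rule inv_equality) (simp_all add: mult one mat_1_in_G_grp)
  moreover have "inv\<^bsub>G_grp W\<^esub> (mat 1) = mat 1"
    using inv_one by (simp add: one)
  ultimately have "subgroup {mat 1, - mat 1} (G_grp W)"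
    by (intro subgroupI) (auto simp: mult mat_1_in_G_grp)
  moreover have "A \<otimes>\<^bsub>G_grp W\<^esub> h \<otimes>\<^bsub>G_grp W\<^esub> inv\<^bsub>G_grp W\<^esub> A \<in> {mat 1, - mat 1}"
    if "A \<in> carrier (G_grp W)" "h \<in> {mat 1, - mat 1}" for A h
    using that r_inv[OF that(1)] by (auto simp: mult one)
  ultimately show ?thesis by (simp add: normal_inv_iff)
qed

text \<open>Powers of the coset are cosets of the powers, and a matrix whose coset is the identity
  coset is itself 1 or -1.\<close>

lemma mat_pow_ord_pr:
  assumes A: "A \<in> carrier (G_grp W)"
  shows "mat_pow A (group.ord (PG_grp W) (pr W A)) \<doteq> mat 1"
proof -
  interpret group "G_grp W" by (rule group_G_grp)
  interpret N: normal "{mat 1, - mat 1}" "G_grp W" by (rule normal_pm1)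
  interpret PG: group "PG_grp W" unfolding PG_grp_def by (rule N.factorgroup_is_group)
  have mult: "A \<otimes>\<^bsub>G_grp W\<^esub> B = A ** B" and one: "\<one>\<^bsub>G_grp W\<^esub> = mat 1" for A B
    by (simp_all add: G_grp_def)
  have one_PG: "\<one>\<^bsub>PG_grp W\<^esub> = {mat 1, - mat 1}"
    by (simp add: PG_grp_def)
  have pow: "A [^]\<^bsub>G_grp W\<^esub> k = mat_pow A k" for k :: nat
    by (induction k) (simp_all add: mult one mat_pow_Suc_right del: mat_pow.simps(2))
  have pr_pow: "pr W A [^]\<^bsub>PG_grp W\<^esub> k = pr W (mat_pow A k)" for k :: nat
  proof (induction k)
    case 0
    show ?case by (auto simp: pr_def PG_grp_def r_coset_def mult)
  next
    case (Suc k)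
    have "pr W (mat_pow A k) \<otimes>\<^bsub>PG_grp W\<^esub> pr W A = pr W (mat_pow A k ** A)"
      unfolding pr_def PG_grp_def mult_FactGroup mult[symmetric]
      using A nat_pow_closed[OF A, of k] by (intro N.rcos_sum) (simp_all add: pow)
    with Suc show ?case by (simp add: mat_pow_Suc_right del: mat_pow.simps(2))
  qed
  have "pr W A \<in> carrier (PG_grp W)"
    using A by (auto simp: pr_def PG_grp_def FactGroup_def RCOSETS_def)
  then have "pr W A [^]\<^bsub>PG_grp W\<^esub> PG.ord (pr W A) = \<one>\<^bsub>PG_grp W\<^esub>"
    by (rule PG.pow_ord_eq_1)
  then have "pr W (mat_pow A (PG.ord (pr W A))) = {mat 1, - mat 1}"
    by (simp only: pr_pow one_PG)
  moreover have "B \<in> pr W B" for B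
    by (auto simp: pr_def r_coset_def mult)
  ultimately have "mat_pow A (PG.ord (pr W A)) \<in> {mat 1, - mat 1}"
    by blast
  then show ?thesis by (auto simp: eq_upto_sign_def)
qed

text \<open>Stated for an arbitrary list of indices so that induction applies. Commutation up to
  sign sorts the factors, and \<open>m a\<close>-th powers being trivial up to sign allows exponents
  to be reduced.\<close>

lemma foldr_mat_pow_mult_upto_sign:
  fixes \<Omega> :: "nat \<Rightarrow> complex^'m^'m" and m :: "nat \<Rightarrow> nat"
  defines "prd \<equiv> \<lambda>as \<alpha>. foldr (\<lambda>a B. mat_pow (\<Omega> a) (\<alpha> a) ** B) as (mat 1)"
  assumes one: "mat 1 \<in> G" and mult: "\<And>A B. A \<in> G \<Longrightarrow> B \<in> G \<Longrightarrow> A ** B \<in> G"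
    and commute: "\<And>A B. A \<in> G \<Longrightarrow> B \<in> G \<Longrightarrow> A ** B \<doteq> B ** A"
    and \<Omega>: "\<And>a. a \<in> set as \<Longrightarrow> \<Omega> a \<in> G"
    and m: "\<And>a. a \<in> set as \<Longrightarrow> mat_pow (\<Omega> a) (m a) \<doteq> mat 1"
    and \<beta>: "\<And>a. a \<in> set as \<Longrightarrow> \<beta> a = (\<alpha> a + \<gamma> a) mod m a"
  shows "prd as \<beta> \<doteq> prd as \<alpha> ** prd as \<gamma>"
  using \<Omega> m \<beta>
proof (induction as)
  case Nil
  show ?case by (simp add: prd_def)
next
  case (Cons a as)
  have pow: "mat_pow A k \<in> G" if "A \<in> G" for A k
    using that by (induction k) (auto intro: one mult)
  have prd: "prd as \<delta> \<in> G" for \<delta>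
  proof -
    have "set bs \<subseteq> set as \<Longrightarrow> prd bs \<delta> \<in> G" for bs
      using Cons.prems(1) by (induction bs) (auto simp: prd_def intro!: one mult pow)
    then show ?thesis by blast
  qed
  let ?p = "mat_pow (\<Omega> a)"
  have \<Omega>a: "\<Omega> a \<in> G" by (simp add: Cons.prems(1))
  \<comment> \<open>Division with remainder splits off a power of \<open>?p (m a)\<close>, which is
    1 up to sign.\<close>
  have "?p (\<alpha> a + \<gamma> a) = mat_pow (?p (m a)) ((\<alpha> a + \<gamma> a) div m a) ** ?p (\<beta> a)"
    by (simp add: Cons.prems(3) flip: mat_pow_mult_exponent mat_pow_add)
  also have "\<dots> \<doteq> mat 1 ** ?p (\<beta> a)"
    by (intro eq_upto_sign_mult eq_upto_sign_refl eq_upto_sign_mat_pow Cons.prems(2)) simp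
  finally have "?p (\<beta> a) \<doteq> ?p (\<alpha> a) ** ?p (\<gamma> a)"
    by (simp add: mat_pow_add eq_upto_sign_sym)
  then have "prd (a # as) \<beta> \<doteq> ?p (\<alpha> a) ** ?p (\<gamma> a) ** (prd as \<alpha> ** prd as \<gamma>)"
    using Cons by (auto simp: prd_def intro!: eq_upto_sign_mult)
  also have "\<dots> = ?p (\<alpha> a) ** (?p (\<gamma> a) ** prd as \<alpha>) ** prd as \<gamma>"
    by (simp add: matrix_mul_assoc)
  also have "\<dots> \<doteq> ?p (\<alpha> a) ** (prd as \<alpha> ** ?p (\<gamma> a)) ** prd as \<gamma>"
    by (intro eq_upto_sign_mult eq_upto_sign_refl commute pow prd \<Omega>a)
  also have "\<dots> = prd (a # as) \<alpha> ** prd (a # as) \<gamma>"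
    by (simp add: prd_def matrix_mul_assoc)
  finally show ?case .
qed

text \<open>Translation modulo \<open>m a\<close> in each coordinate. All exponents lie below
  \<open>m a\<close>, so equal translates come from equal exponents, and an injective self-map of a
  finite set is bijective.\<close>

lemma bij_betw_Sigma0_add:
  assumes \<gamma>: "\<gamma> \<in> Sigma0 N m"
  shows "bij_betw (\<lambda>\<alpha>. \<lambda>a\<in>{1..N}. (\<alpha> a + \<gamma> a) mod m a) (Sigma0 N m) (Sigma0 N m)"
proof -
  let ?\<pi> = "\<lambda>\<alpha>. \<lambda>a\<in>{1..N}. (\<alpha> a + \<gamma> a) mod m a"
  have fin: "finite (Sigma0 N m)" unfolding Sigma0_def by (intro finite_PiE) auto
  have less: "\<alpha> a < m a" if "\<alpha> \<in> Sigma0 N m" "a \<in> {1..N}" for \<alpha> a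
    using PiE_mem[OF that(1)[unfolded Sigma0_def] that(2)] by simp
  have maps: "?\<pi> ` Sigma0 N m \<subseteq> Sigma0 N m"
    using less[OF \<gamma>] by (fastforce simp: Sigma0_def)
  have "inj_on ?\<pi> (Sigma0 N m)"
  proof (rule inj_onI)
    fix \<alpha> \<beta> assume \<alpha>: "\<alpha> \<in> Sigma0 N m" and \<beta>: "\<beta> \<in> Sigma0 N m" and eq: "?\<pi> \<alpha> = ?\<pi> \<beta>"
    show "\<alpha> = \<beta>"
    proof (rule PiE_ext[OF \<alpha>[unfolded Sigma0_def] \<beta>[unfolded Sigma0_def]])
      fix a assume a: "a \<in> {1..N}"
      have "(\<alpha> a + \<gamma> a) mod m a = (\<beta> a + \<gamma> a) mod m a"
        using fun_cong[OF eq, of a] a by simp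
      then show "\<alpha> a = \<beta> a"
        using less[OF \<alpha> a] less[OF \<beta> a] less[OF \<gamma> a]
        by (auto simp: mod_if le_mod_geq split: if_splits)
    qed
  qed
  with maps fin show ?thesis by (simp add: bij_betw_def endo_inj_surj)
qed

section \<open>Passage from the given group to the abstract Lax system\<close>

theorem theorem5:
  fixes W :: "real^'m^'m" and n N :: nat
    and G0 :: "(complex^'m^'m) set"
    and \<Omega> :: "nat \<Rightarrow> complex^'m^'m" and m :: "nat \<Rightarrow> nat"
    and \<omega> :: "complex^'m^'m \<Rightarrow> complex"
    and lam :: "'r::finite \<Rightarrow> real" and \<kappa> :: real
    and K \<theta>1 \<theta>2 :: "complex^'m^'m"
  assumes dim: "CARD('m) = 2 * n"
    and W_inv: "invertible W" and W_antisym: "transpose W = - W"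
    and G0_finite: "finite G0" and G0_subgroup: "subgroup G0 (G_grp W)"
    and G0_conj: "\<forall>A\<in>G0. conj_mat A ** A = mat 1 \<or> conj_mat A ** A = - mat 1"
    and Omega_in: "\<forall>a\<in>{1..N}. \<Omega> a \<in> G0"
    and Omega_gen: "generate (PG_grp W) ((\<lambda>a. pr W (\<Omega> a)) ` {1..N}) = pr W ` G0"
    and m_ord: "\<forall>a\<in>{1..N}. m a = group.ord (PG_grp W) (pr W (\<Omega> a))"
    and omega_hom: "\<omega> \<in> hom (G_grp W\<lparr>carrier := G0\<rparr>) circle_grp"
    and omega_pm1: "\<forall>A\<in>G0 \<inter> {mat 1, - mat 1}. \<omega> A = 1"
    and lam_nonzero: "\<forall>\<sigma>. lam \<sigma> \<noteq> 0" and lam_sq_distinct: "inj (\<lambda>\<sigma>. (lam \<sigma>)\<^sup>2)"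
    and K_D1: "K \<in> D1 W G0 \<omega>"
    and theta1_comm: "\<forall>z\<in>Lax_dom N \<Omega> m \<omega> lam. \<forall>\<Phi>. commutator \<theta>1 (Lax W N \<Omega> m \<omega> lam \<kappa> K z \<Phi>) = 0"
    and theta2_comm: "\<forall>z\<in>Lax_dom N \<Omega> m \<omega> lam. \<forall>\<Phi>. commutator \<theta>2 (Lax W N \<Omega> m \<omega> lam \<kappa> K z \<Phi>) = 0"
  shows "\<forall>k l :: nat. \<forall>z w :: complex. \<forall>\<Phi>. 0 < k \<longrightarrow> 0 < l \<longrightarrow>
    z \<in> Lax_dom N \<Omega> m \<omega> lam \<longrightarrow> w \<in> Lax_dom N \<Omega> m \<omega> lam \<longrightarrow>
    poisson W (\<lambda>\<Psi>. trace (\<theta>1 ** mat_pow (Lax W N \<Omega> m \<omega> lam \<kappa> K z \<Psi>) k))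
              (\<lambda>\<Psi>. trace (\<theta>2 ** mat_pow (Lax W N \<Omega> m \<omega> lam \<kappa> K w \<Psi>) l)) \<Phi> = 0"
proof -
  let ?Wi = "cmat (matrix_inv W)"
  have mult: "A \<otimes>\<^bsub>G_grp W\<^esub> B = A ** B" and unit: "\<one>\<^bsub>G_grp W\<^esub> = mat 1" for A B
    by (simp_all add: G_grp_def)
  have G0_G: "A \<in> carrier (G_grp W)" if "A \<in> G0" for A
    using G0_subgroup that by (rule subgroup.mem_carrier)
  have G0_1: "mat 1 \<in> G0"
    using subgroup.one_closed[OF G0_subgroup] by (simp add: unit)
  have G0_mult: "A ** B \<in> G0" if "A \<in> G0" "B \<in> G0" for A B
    using subgroup.m_closed[OF G0_subgroup that] by (simp add: mult)
  have G0_pow: "mat_pow A k \<in> G0" if "A \<in> G0" for A k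
    using that by (induction k) (auto intro: G0_1 G0_mult)
  \<comment> \<open>The condition on conjugates holds for the two factors and, as \<open>G0\<close>
    is closed, for their product: this is how \<open>pr W\<close> of \<open>G0\<close> is seen to be
    Abelian.\<close>
  have G0_commute: "A ** B \<doteq> B ** A" if "A \<in> G0" "B \<in> G0" for A B
    using G0_conj that G0_mult[OF that] by (intro commute_upto_sign) (auto simp: eq_upto_sign_def)
  have \<Omega>_G0: "\<Omega> a \<in> G0" if "a \<in> {1..N}" for a
    using Omega_in that by blast
  have \<Omega>_ord: "mat_pow (\<Omega> a) (m a) \<doteq> mat 1" if "a \<in> {1..N}" for a
    using mat_pow_ord_pr[OF G0_G[OF \<Omega>_G0[OF that]]] m_ord that by simp
  have \<omega>_mult: "\<omega> (A ** B) = \<omega> A * \<omega> B" if "A \<in> G0" "B \<in> G0" for A B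
    using omega_hom that by (auto simp: hom_def circle_grp_def mult)
  have \<omega>_circle: "cmod (\<omega> A) = 1" if "A \<in> G0" for A
    using omega_hom that by (auto simp: hom_def circle_grp_def Pi_def)
  have \<omega>_pow: "\<omega> (mat_pow A k) = \<omega> A ^ k" if "A \<in> G0" for A k
    using that omega_pm1 G0_1 by (induction k) (auto simp: \<omega>_mult G0_pow)
  \<comment> \<open>\<open>\<omega>\<close> is trivial on 1 and -1, so the sign ambiguity of the
    power is invisible to it.\<close>
  have \<omega>_ord: "\<omega> (\<Omega> a) ^ m a = 1" if "a \<in> {1..N}" for a
  proof -
    have "mat_pow (\<Omega> a) (m a) \<in> G0 \<inter> {mat 1, - mat 1}"
      using \<Omega>_ord[OF that] G0_pow[OF \<Omega>_G0[OF that]] by (auto simp: eq_upto_sign_def)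
    then have "\<omega> (mat_pow (\<Omega> a) (m a)) = 1" using omega_pm1 by blast
    then show ?thesis by (simp add: \<omega>_pow \<Omega>_G0[OF that])
  qed
  have K_lie: "transpose K = - (cmat W ** K ** matrix_inv (cmat W))"
    and K_G0: "A ** K ** matrix_inv A = scale_mat (\<omega> A) K" if "A \<in> G0" for A
    using K_D1 that by (auto simp: D1_def lie_alg_def)
  have K_twist: "A ** K = scale_mat (\<omega> A) (K ** A)" if "A \<in> G0" for A
  proof -
    have "invertible A" using G0_G[OF that] by (simp add: G_grp_def)
    then have "A ** K = A ** K ** matrix_inv A ** A"
      by (metis matrix_inv_mult(2) matrix_mul_assoc matrix_mul_rid)
    then show ?thesis by (simp add: K_G0[OF that])
  qed
  have foldr_G0: "foldr (\<lambda>a B. mat_pow (\<Omega> a) (\<alpha> a) ** B) as (mat 1) \<in> G0 \<and>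
      \<omega> (foldr (\<lambda>a B. mat_pow (\<Omega> a) (\<alpha> a) ** B) as (mat 1)) = (\<Prod>a\<leftarrow>as. \<omega> (\<Omega> a) ^ \<alpha> a)"
    if "set as \<subseteq> {1..N}" for as \<alpha>
    using that
  proof (induction as)
    case Nil
    then show ?case using omega_pm1 G0_1 by simp
  next
    case (Cons a as)
    then show ?case by (simp add: G0_mult G0_pow \<omega>_mult \<omega>_pow \<Omega>_G0)
  qed
  have Omega_pow_G0: "Omega_pow N \<Omega> \<alpha> \<in> G0"
    and \<omega>_Omega_pow: "\<omega> (Omega_pow N \<Omega> \<alpha>) = omega_pow N \<Omega> \<omega> \<alpha>" for \<alpha>
  proof -
    have "(\<Prod>a\<leftarrow>[1..<Suc N]. \<omega> (\<Omega> a) ^ \<alpha> a) = omega_pow N \<Omega> \<omega> \<alpha>"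
      unfolding omega_pow_def by (subst prod.distinct_set_conv_list[symmetric])
        (simp_all add: atLeastLessThanSuc_atLeastAtMost del: upt_Suc)
    moreover have "set [1..<Suc N] \<subseteq> {1..N}" by auto
    ultimately show "Omega_pow N \<Omega> \<alpha> \<in> G0" "\<omega> (Omega_pow N \<Omega> \<alpha>) = omega_pow N \<Omega> \<omega> \<alpha>"
      unfolding Omega_pow_def using foldr_G0[of "[1..<Suc N]" \<alpha>] by simp_all
  qed
  \<comment> \<open>The witness adds exponents modulo \<open>m a\<close>: exact for
    \<omega>^\<alpha>, but correct only up to sign for \<Omega>^\<alpha>.\<close>
  have shift: "\<exists>\<pi>. bij_betw \<pi> (Sigma0 N m) (Sigma0 N m) \<and> (\<forall>\<alpha>\<in>Sigma0 N m.
      omega_pow N \<Omega> \<omega> (\<pi> \<alpha>) = omega_pow N \<Omega> \<omega> \<gamma> * omega_pow N \<Omega> \<omega> \<alpha> \<and>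
      Omega_pow N \<Omega> (\<pi> \<alpha>) \<doteq> Omega_pow N \<Omega> \<gamma> ** Omega_pow N \<Omega> \<alpha> \<and>
      Omega_pow N \<Omega> (\<pi> \<alpha>) \<doteq> Omega_pow N \<Omega> \<alpha> ** Omega_pow N \<Omega> \<gamma>)"
    if \<gamma>: "\<gamma> \<in> Sigma0 N m" for \<gamma>
  proof -
    let ?\<pi> = "\<lambda>\<alpha>. \<lambda>a\<in>{1..N}. (\<alpha> a + \<gamma> a) mod m a"
    have "omega_pow N \<Omega> \<omega> (?\<pi> \<alpha>) = omega_pow N \<Omega> \<omega> \<gamma> * omega_pow N \<Omega> \<omega> \<alpha>" for \<alpha>
    proof -
      have "\<omega> (\<Omega> a) ^ ((\<alpha> a + \<gamma> a) mod m a) = \<omega> (\<Omega> a) ^ \<gamma> a * \<omega> (\<Omega> a) ^ \<alpha> a"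
        if "a \<in> {1..N}" for a
      proof -
        have "\<omega> (\<Omega> a) ^ (\<alpha> a + \<gamma> a) = (\<omega> (\<Omega> a) ^ m a) ^ ((\<alpha> a + \<gamma> a) div m a)
            * \<omega> (\<Omega> a) ^ ((\<alpha> a + \<gamma> a) mod m a)"
          by (simp flip: power_mult power_add)
        then show ?thesis by (simp add: \<omega>_ord[OF that] power_add mult.commute)
      qed
      then show ?thesis by (simp add: omega_pow_def flip: prod.distrib)
    qed
    moreover have right: "Omega_pow N \<Omega> (?\<pi> \<alpha>) \<doteq> Omega_pow N \<Omega> \<alpha> ** Omega_pow N \<Omega> \<gamma>" for \<alpha>
      unfolding Omega_pow_def
      by (rule foldr_mat_pow_mult_upto_sign[where G = G0 and m = m])
         (auto intro!: G0_1 G0_mult G0_commute \<Omega>_G0 \<Omega>_ord)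
    moreover have "Omega_pow N \<Omega> (?\<pi> \<alpha>) \<doteq> Omega_pow N \<Omega> \<gamma> ** Omega_pow N \<Omega> \<alpha>" for \<alpha>
      using right G0_commute[OF Omega_pow_G0 Omega_pow_G0] by (rule eq_upto_sign_trans)
    ultimately show ?thesis using bij_betw_Sigma0_add[OF \<gamma>] by blast
  qed
  have W_Wi: "cmat W ** ?Wi = mat 1" "?Wi ** cmat W = mat 1"
    using matrix_inv_mult[OF W_inv] by (simp_all flip: cmat_mult)
  interpret L: lax_system "cmat W" ?Wi "Sigma0 N m" "Omega_pow N \<Omega>" "omega_pow N \<Omega> \<omega>"
    "\<lambda>\<sigma>. complex_of_real (lam \<sigma>)" "complex_of_real \<kappa>" K
  proof
    show "cmat W ** ?Wi = mat 1" "?Wi ** cmat W = mat 1" by (fact W_Wi)+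
    show "transpose (cmat W) = - cmat W"
    proof -
      have "transpose (cmat W) = cmat (transpose W)" by (simp add: vec_eq_iff transpose_def)
      then show ?thesis by (simp add: W_antisym vec_eq_iff)
    qed
    show "finite (Sigma0 N m)" unfolding Sigma0_def by (intro finite_PiE) auto
    show "transpose (Omega_pow N \<Omega> \<alpha>) ** cmat W ** Omega_pow N \<Omega> \<alpha> = cmat W" for \<alpha>
      using G0_G[OF Omega_pow_G0] by (simp add: G_grp_def)
    show "omega_pow N \<Omega> \<omega> \<alpha> \<noteq> 0" for \<alpha>
      using \<omega>_circle[OF Omega_pow_G0] by (metis \<omega>_Omega_pow norm_zero zero_neq_one)
    show "?Wi ** transpose K ** cmat W = - K"
    proof -
      \<comment> \<open>The Lie algebra condition is rewritten in adjoint form, once the inverse of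
        the complexified \<open>W\<close> is identified with \<open>?Wi\<close>.\<close>
      have "?Wi ** transpose K ** cmat W = - ((?Wi ** cmat W) ** K ** (?Wi ** cmat W))"
        by (simp add: K_lie[OF G0_1] matrix_inv_eqI[OF W_Wi] matrix_mul_assoc)
      then show ?thesis by (simp add: W_Wi)
    qed
    show "Omega_pow N \<Omega> \<alpha> ** K = scale_mat (omega_pow N \<Omega> \<omega> \<alpha>) (K ** Omega_pow N \<Omega> \<alpha>)" for \<alpha>
      using K_twist[OF Omega_pow_G0] by (simp add: \<omega>_Omega_pow)
  qed (use shift in \<open>simp add: eq_upto_sign_def\<close>)
  have lax: "L.lax = Lax W N \<Omega> m \<omega> lam \<kappa> K"
    by (intro ext) (simp add: L.lax_def Lax_def)
  have dom: "L.dom = Lax_dom N \<Omega> m \<omega> lam"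
    by (simp add: L.dom_def Lax_dom_def)
  show ?thesis
  proof (intro allI impI)
    fix k l :: nat and z w \<Phi>
    assume "z \<in> Lax_dom N \<Omega> m \<omega> lam" "w \<in> Lax_dom N \<Omega> m \<omega> lam"
    moreover have "\<theta>1 ** L.lax v \<Psi> = L.lax v \<Psi> ** \<theta>1" "\<theta>2 ** L.lax v \<Psi> = L.lax v \<Psi> ** \<theta>2"
      if "v \<in> L.dom" for v \<Psi>
      using theta1_comm theta2_comm that by (simp_all add: lax dom commutator_def)
    ultimately show "poisson W (\<lambda>\<Psi>. trace (\<theta>1 ** mat_pow (Lax W N \<Omega> m \<omega> lam \<kappa> K z \<Psi>) k))
        (\<lambda>\<Psi>. trace (\<theta>2 ** mat_pow (Lax W N \<Omega> m \<omega> lam \<kappa> K w \<Psi>) l)) \<Phi> = 0"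
      using L.poisson_trace_lax_pow[of \<theta>1 \<theta>2 z w k \<Phi> l]
      by (simp add: poisson_def lax dom)
  qed
qed

end
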